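(* Let $N$ be a squarefree integer and let $n$ be an odd positive integer coprime to $N$. Then \[ \sqrt{n}\ll_N \sum_{t\in\mathbb Z,\ t^2<4n}|D_N\left(t,n\right)|^2\ll_N \sqrt{n} \left(\log n\right)^2 \left(\log \log n\right)^4. \]
   Context: $\sigma$ is the divisor-counting function, $\mu$ the Möbius function. For $D<0$, $h_w(D)$ is the weighted class number of positive definite binary quadratic forms of discriminant $D$ (forms proportional to $x^2+y^2$ weighted $\frac12$, to $x^2+xy+y^2$ weighted $\frac13$). Let $\nu(N)=N\prod_{p\mid N}(1+\frac1p)$; $M(t,n,K)$ the number of solutions mod $K$ of $x^2-tx+n\equiv0\pmod K$; $\mu(t,f,n,N)=\frac{\nu(N)}{\nu(N/\gcd(N,f))}M(t,n,N\gcd(N,f))$; $\tilde\mu(t,f,n,N)=\sum_{d\mid N}\sigma(N/d)\mu(N/d)\mu(t,f,n,d)$; and for $t^2<4n$, \[ D_N\left(t,n\right) = \frac{i}{2\sqrt{4n-t^2}} \sum_{f} h_w \left(\frac{t^2-4n}{f^2}\right) \tilde{\mu}\left(t,f,n,N\right), \] the sum over positive integers $f$ with $f^2\mid t^2-4n$ and $(t^2-4n)/f^2\equiv0$ or $1\pmod4$.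
   Formalization: The lower bound is stated for n ≥ n₀(N), since for all n it fails (N=13, n=1 gives sum 0), and the upper bound for n > 1, since log log 1 is undefined; N is taken positive. *)

theory Defs
  imports "HOL-Analysis.Analysis" "HOL-Number_Theory.Number_Theory"
    "HOL-Computational_Algebra.Squarefree"
begin

definition divisor_count :: "nat \<Rightarrow> nat" where
  "divisor_count n = card {d. d dvd n}"

definition moebius :: "nat \<Rightarrow> int" where
  "moebius n = (if squarefree n then (- 1) ^ card (prime_factors n) else 0)"

text \<open>The triple \<open>(a, b, c)\<close> stands for the form \<open>a x\<^sup>2 + b x y + c y\<^sup>2\<close>.\<close>

type_synonym bqf = "int \<times> int \<times> int"

fun bqf_eval :: "bqf \<Rightarrow> int \<Rightarrow> int \<Rightarrow> int" where
  "bqf_eval (a, b, c) x y = a * x\<^sup>2 + b * x * y + c * y\<^sup>2"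

fun bqf_disc :: "bqf \<Rightarrow> int" where
  "bqf_disc (a, b, c) = b\<^sup>2 - 4 * a * c"

definition bqf_pos_def :: "bqf \<Rightarrow> bool" where
  "bqf_pos_def Q \<longleftrightarrow> (\<forall>x y. (x, y) \<noteq> (0, 0) \<longrightarrow> bqf_eval Q x y > 0)"

text \<open>Proper equivalence, that is, modulo the action of \<open>SL\<^sub>2(\<int>)\<close>.\<close>

definition bqf_equiv :: "(bqf \<times> bqf) set" where
  "bqf_equiv = {(Q, R). \<exists>p q r s. p * s - q * r = 1 \<and>
     (\<forall>x y. bqf_eval R x y = bqf_eval Q (p * x + q * y) (r * x + s * y))}"

definition pos_def_forms :: "int \<Rightarrow> bqf set" where
  "pos_def_forms D = {Q. bqf_pos_def Q \<and> bqf_disc Q = D}"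

definition class_weight :: "bqf set \<Rightarrow> real" where
  "class_weight C =
     (if \<exists>k. (k, 0, k) \<in> C then 1 / 2
      else if \<exists>k. (k, k, k) \<in> C then 1 / 3
      else 1)"

text \<open>
  All positive definite forms are counted, not only the primitive ones, so that
  \<open>weighted_class_number (- m)\<close> is the Hurwitz class number of \<open>m > 0\<close>.
\<close>

definition weighted_class_number :: "int \<Rightarrow> real" where
  "weighted_class_number D = (\<Sum>C \<in> pos_def_forms D // bqf_equiv. class_weight C)"

definition nu :: "nat \<Rightarrow> real" where
  "nu N = real N * (\<Prod>p \<in> prime_factors N. 1 + 1 / real p)"

definition num_sols :: "int \<Rightarrow> nat \<Rightarrow> nat \<Rightarrow> nat" where
  "num_sols t n K = card {x \<in> {0..<int K}. [x\<^sup>2 - t * x + int n = 0] (mod int K)}"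

definition mu :: "int \<Rightarrow> nat \<Rightarrow> nat \<Rightarrow> nat \<Rightarrow> real" where
  "mu t f n N = nu N / nu (N div gcd N f) * real (num_sols t n (N * gcd N f))"

definition mu_tilde :: "int \<Rightarrow> nat \<Rightarrow> nat \<Rightarrow> nat \<Rightarrow> real" where
  "mu_tilde t f n N =
     (\<Sum>d | d dvd N. real (divisor_count (N div d)) * of_int (moebius (N div d)) * mu t f n d)"

definition conductors :: "int \<Rightarrow> nat set" where
  "conductors D = {f. f > 0 \<and> (int f)\<^sup>2 dvd D \<and> (D div (int f)\<^sup>2) mod 4 \<in> {0, 1}}"

definition D_coeff :: "nat \<Rightarrow> int \<Rightarrow> nat \<Rightarrow> complex" where
  "D_coeff N t n =
     \<i> / complex_of_real (2 * sqrt (real_of_int (4 * int n - t\<^sup>2))) *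
     complex_of_real (\<Sum>f \<in> conductors (t\<^sup>2 - 4 * int n).
        weighted_class_number ((t\<^sup>2 - 4 * int n) div (int f)\<^sup>2) * mu_tilde t f n N)"

end

theory Submission
  imports Defs
begin

text \<open>
  Put \<open>m = 4 n - t\<^sup>2\<close>, let \<open>H m\<close> be the class number of discriminant \<open>- m\<close>, and write \<open>S k\<close> for the
  sum of the reciprocals of the divisors of \<open>k\<close>.

  Upper bound. \<open>H m\<close> is at most the number of reduced forms \<open>(a, b, c)\<close>, hence at most the
  number of roots of \<open>b\<^sup>2 \<equiv> - m\<close> modulo \<open>a\<close> with \<open>a \<le> sqrt m\<close>. Such roots are controlled by the factorisations
  \<open>a = d e\<close>, and summing over them gives \<open>H m \<lesssim> sqrt m ln m S(4 m)\<close>. The sum over the conductors contributes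
  a second factor \<open>S(4 m)\<close>, and \<open>S k \<lesssim> ln (ln k)\<close>. So every single coefficient is
  \<open>\<lesssim> ln n (ln (ln n))\<^sup>2\<close>.

  Lower bound. The map \<open>x \<mapsto> x + n / x\<close> on the units modulo a prime \<open>p\<close> dividing \<open>N\<close> misses some residue, so there is
  a class \<open>t\<^sub>0\<close> modulo \<open>N\<close> for which \<open>x\<^sup>2 - t\<^sub>0 x + n\<close> has no root modulo any such \<open>p\<close>. On this class all terms of
  \<open>mu_tilde\<close> except \<open>d = 1\<close> vanish, which makes it a nonzero constant, and the coefficient
  dominates \<open>H m / sqrt n\<close>. By Cauchy-Schwarz it is enough that the sum of \<open>H m\<close> over this class is \<open>\<greatersim> n\<close>.
  That sum is bounded below by counting pairs \<open>(a, u)\<close> with \<open>a\<close> dividing \<open>u\<^sup>2 + t u + n\<close>, each of which yields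
  a reduced form: for coprime \<open>a\<close>, \<open>u\<close> the divisibility is a congruence condition on \<open>t\<close>.
\<close>

section \<open>Reduction of positive definite forms\<close>

lemma bqf_equiv_iff:
  "((a, b, c), (a', b', c')) \<in> bqf_equiv \<longleftrightarrow>
     (\<exists>p q r s. p * s - q * r = 1 \<and> a' = a * p\<^sup>2 + b * p * r + c * r\<^sup>2 \<and>
        b' = 2 * a * p * q + b * (p * s + q * r) + 2 * c * r * s \<and>
        c' = a * q\<^sup>2 + b * q * s + c * s\<^sup>2)"
  (is "_ \<longleftrightarrow> ?R")
proof
  assume "((a, b, c), (a', b', c')) \<in> bqf_equiv"
  then obtain p q r s where det: "p * s - q * r = 1"
    and ev: "\<And>x y. bqf_eval (a', b', c') x y = bqf_eval (a, b, c) (p * x + q * y) (r * x + s * y)"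
    unfolding bqf_equiv_def by auto
  \<comment> \<open>The values at (1, 0), (0, 1) and (1, 1) determine the coefficients of a
    form.\<close>
  have 1: "a' = a * p\<^sup>2 + b * p * r + c * r\<^sup>2" using ev[of 1 0] by simp
  have 2: "c' = a * q\<^sup>2 + b * q * s + c * s\<^sup>2" using ev[of 0 1] by simp
  have "a' + b' + c' = a * (p + q)\<^sup>2 + b * (p + q) * (r + s) + c * (r + s)\<^sup>2"
    using ev[of 1 1] by simp
  hence "b' = 2 * a * p * q + b * (p * s + q * r) + 2 * c * r * s"
    unfolding 1 2 by (simp add: power2_eq_square algebra_simps)
  with 1 2 det show ?R by blast
next
  assume ?R
  then obtain p q r s where *: "p * s - q * r = 1" "a' = a * p\<^sup>2 + b * p * r + c * r\<^sup>2"
        "b' = 2 * a * p * q + b * (p * s + q * r) + 2 * c * r * s"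
        "c' = a * q\<^sup>2 + b * q * s + c * s\<^sup>2" by blast
  have "bqf_eval (a', b', c') x y = bqf_eval (a, b, c) (p * x + q * y) (r * x + s * y)" for x y
    unfolding * by (simp add: power2_eq_square algebra_simps)
  with * show "((a, b, c), (a', b', c')) \<in> bqf_equiv" unfolding bqf_equiv_def by blast
qed

lemma equiv_bqf_equiv: "equiv UNIV bqf_equiv"
proof (rule equivI)
  show "refl bqf_equiv"
  proof (rule reflI)
    fix Q :: bqf
    have "(1::int) * 1 - 0 * 0 = 1 \<and> (\<forall>x y. bqf_eval Q x y = bqf_eval Q (1 * x + 0 * y) (0 * x + 1 * y))"
      by simp
    thus "(Q, Q) \<in> bqf_equiv" unfolding bqf_equiv_def by blast
  qed
  show "sym bqf_equiv"
  proof (rule symI)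
    fix Q R assume "(Q, R) \<in> bqf_equiv"
    then obtain p q r s where det: "p * s - q * r = 1"
      and ev: "\<And>x y. bqf_eval R x y = bqf_eval Q (p * x + q * y) (r * x + s * y)"
      unfolding bqf_equiv_def by auto
    have "bqf_eval Q x y = bqf_eval R (s * x + (- q) * y) ((- r) * x + p * y)" for x y
    proof -
      have "p * (s * x + (- q) * y) + q * ((- r) * x + p * y) = (p * s - q * r) * x"
           "r * (s * x + (- q) * y) + s * ((- r) * x + p * y) = (p * s - q * r) * y"
        by (simp_all add: algebra_simps)
      thus ?thesis by (simp only: ev det mult_1)
    qed
    moreover have "s * p - (- q) * (- r) = 1" using det by (simp add: algebra_simps)
    ultimately show "(R, Q) \<in> bqf_equiv" unfolding bqf_equiv_def by blast
  qed
  show "trans bqf_equiv"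
  proof (rule transI)
    fix Q R S assume "(Q, R) \<in> bqf_equiv" "(R, S) \<in> bqf_equiv"
    then obtain p q r s p' q' r' s' where det: "p * s - q * r = 1" "p' * s' - q' * r' = 1"
      and ev: "\<And>x y. bqf_eval R x y = bqf_eval Q (p * x + q * y) (r * x + s * y)"
       "\<And>x y. bqf_eval S x y = bqf_eval R (p' * x + q' * y) (r' * x + s' * y)"
      unfolding bqf_equiv_def by auto
    have "bqf_eval S x y = bqf_eval Q ((p * p' + q * r') * x + (p * q' + q * s') * y)
            ((r * p' + s * r') * x + (r * q' + s * s') * y)" for x y
      unfolding ev by (rule arg_cong2[where f = "bqf_eval Q"]) (simp_all add: algebra_simps)
    moreover have "(p * p' + q * r') * (r * q' + s * s') - (p * q' + q * s') * (r * p' + s * r') =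
        (p * s - q * r) * (p' * s' - q' * r')" by (simp add: algebra_simps)
    hence "(p * p' + q * r') * (r * q' + s * s') - (p * q' + q * s') * (r * p' + s * r') = 1"
      using det by simp
    ultimately show "(Q, S) \<in> bqf_equiv" unfolding bqf_equiv_def by blast
  qed
qed auto

lemma bqf_disc_equiv:
  assumes "(Q, R) \<in> bqf_equiv"
  shows "bqf_disc R = bqf_disc Q"
proof -
  obtain a b c a' b' c' where [simp]: "Q = (a, b, c)" "R = (a', b', c')"
    by (metis prod.exhaust)
  obtain p q r s where *: "p * s - q * r = 1" "a' = a * p\<^sup>2 + b * p * r + c * r\<^sup>2"
        "b' = 2 * a * p * q + b * (p * s + q * r) + 2 * c * r * s"
        "c' = a * q\<^sup>2 + b * q * s + c * s\<^sup>2" using assms by (auto simp: bqf_equiv_iff)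
  have "b'\<^sup>2 - 4 * a' * c' = (b\<^sup>2 - 4 * a * c) * (p * s - q * r)\<^sup>2"
    unfolding *(2-4) by (simp add: power2_eq_square algebra_simps)
  thus ?thesis by (simp add: *(1))
qed

lemma bqf_pos_def_equiv:
  assumes "(Q, R) \<in> bqf_equiv" "bqf_pos_def Q"
  shows "bqf_pos_def R"
proof -
  obtain p q r s where det: "p * s - q * r = 1"
      and ev: "\<And>x y. bqf_eval R x y = bqf_eval Q (p * x + q * y) (r * x + s * y)"
      using assms(1) unfolding bqf_equiv_def by auto
  have "bqf_eval R x y > 0" if "(x, y) \<noteq> (0, 0)" for x y
  proof -
    have "(p * x + q * y, r * x + s * y) \<noteq> (0, 0)"
    proof
      assume "(p * x + q * y, r * x + s * y) = (0, 0)"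
      hence 0: "p * x + q * y = 0" "r * x + s * y = 0" by simp_all
      have "(p * s - q * r) * x = s * (p * x + q * y) - q * (r * x + s * y)"
           "(p * s - q * r) * y = p * (r * x + s * y) - r * (p * x + q * y)"
        by (simp_all add: algebra_simps)
      with det 0 that show False by simp
    qed
    thus ?thesis using assms(2) unfolding bqf_pos_def_def ev by blast
  qed
  thus ?thesis by (simp add: bqf_pos_def_def)
qed

section \<open>Reduced representatives and finiteness of the set of classes\<close>

definition reduced_forms :: "int \<Rightarrow> bqf set" where
  "reduced_forms m = {(a, b, c). 0 < a \<and> \<bar>b\<bar> \<le> a \<and> a \<le> c \<and> 4 * a * c - b\<^sup>2 = m}"

text \<open>Gauss reduction by minimality: among all equivalent forms take one with least leading
  coefficient and translate the middle coefficient into range. The last coefficient is itself the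
  leading coefficient of an equivalent form, hence not smaller than \<open>a\<close>.\<close>

lemma bqf_equiv_reduced:
  assumes "Q \<in> pos_def_forms (- m)"
  shows "\<exists>R \<in> reduced_forms m. (Q, R) \<in> bqf_equiv"
proof -
  have pd: "bqf_pos_def Q" and disc: "bqf_disc Q = - m"
    using assms by (auto simp: pos_def_forms_def)
  have rfl: "(Q, Q) \<in> bqf_equiv"
    using equiv_bqf_equiv by (meson UNIV_I equiv_def refl_onD)
  have tr: "(Q, S) \<in> bqf_equiv" if "(Q, R) \<in> bqf_equiv" "(R, S) \<in> bqf_equiv" for R S
    using equiv_bqf_equiv that by (meson equiv_def transD)
  obtain R where R: "(Q, R) \<in> bqf_equiv"
    and min: "\<And>R'. (Q, R') \<in> bqf_equiv \<Longrightarrow> nat (fst R) \<le> nat (fst R')"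
    using ex_has_least_nat[of "\<lambda>R. (Q, R) \<in> bqf_equiv" Q "\<lambda>R. nat (fst R)"] rfl by blast
  obtain a b c where Rabc: "R = (a, b, c)" by (metis prod.exhaust)
  have "bqf_eval (a, b, c) 1 0 > 0"
    using bqf_pos_def_equiv[OF R pd] unfolding Rabc bqf_pos_def_def by (metis prod.inject zero_neq_one)
  hence apos: "a > 0" by simp
  \<comment> \<open>The translation \<open>x + k y\<close> for which \<open>b'\<close> is the
    residue of \<open>b\<close> modulo \<open>2 * a\<close> in [-a, a).\<close>
  define k where "k = - ((b + a) div (2 * a))"
  define b' where "b' = b + 2 * a * k"
  define c' where "c' = a * k\<^sup>2 + b * k + c"
  have b'_eq: "b' = (b + a) mod (2 * a) - a"
    unfolding b'_def k_def using div_mult_mod_eq[of "b + a" "2 * a"] by (simp add: algebra_simps)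
  have b': "\<bar>b'\<bar> \<le> a"
    using pos_mod_bound[of "2 * a" "b + a"] pos_mod_sign[of "2 * a" "b + a"] apos
    unfolding b'_eq by linarith
  have R1: "(R, (a, b', c')) \<in> bqf_equiv"
    unfolding Rabc bqf_equiv_iff
    by (rule exI[of _ 1], rule exI[of _ k], rule exI[of _ 0], rule exI[of _ 1])
       (simp add: b'_def c'_def)
  \<comment> \<open>The rotation by a right angle exchanges the outer coefficients.\<close>
  have R2: "((a, b', c'), (c', - b', a)) \<in> bqf_equiv"
    unfolding bqf_equiv_iff
    by (rule exI[of _ 0], rule exI[of _ 1], rule exI[of _ "- 1"], rule exI[of _ 0]) simp
  have QR1: "(Q, (a, b', c')) \<in> bqf_equiv" by (rule tr[OF R R1])
  have "nat a \<le> nat c'" using min[OF tr[OF QR1 R2]] by (simp add: Rabc)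
  hence "a \<le> c'" using apos by linarith
  moreover have "4 * a * c' - b'\<^sup>2 = m" using bqf_disc_equiv[OF QR1] disc by simp
  ultimately have "(a, b', c') \<in> reduced_forms m"
    using apos b' by (auto simp: reduced_forms_def)
  with QR1 show ?thesis by blast
qed

lemma reduced_form_bound:
  assumes "(a, b, c) \<in> reduced_forms m"
  shows "3 * a\<^sup>2 \<le> m"
proof -
  have h: "0 < a" "\<bar>b\<bar> \<le> a" "a \<le> c" "4 * a * c - b\<^sup>2 = m"
    using assms by (auto simp: reduced_forms_def)
  have "a * a \<le> a * c" using h by (intro mult_left_mono) auto
  moreover have "b\<^sup>2 \<le> a\<^sup>2" using h by (metis abs_le_square_iff abs_of_pos)
  ultimately show ?thesis using h(4) by (simp add: power2_eq_square)
qed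

lemma finite_reduced_forms: "finite (reduced_forms m)"
proof (rule finite_subset)
  show "reduced_forms m \<subseteq> {0..m} \<times> {-m..m} \<times> {0..2*m}"
  proof (clarsimp simp only: mem_Times_iff subset_iff)
    fix a b c assume R: "(a, b, c) \<in> reduced_forms m"
    have h: "0 < a" "\<bar>b\<bar> \<le> a" "a \<le> c" "4 * a * c - b\<^sup>2 = m"
      using R by (auto simp: reduced_forms_def)
    have am: "a \<le> m" using reduced_form_bound[OF R] h(1) self_le_power[of a 2] by linarith
    have "b\<^sup>2 \<le> a\<^sup>2" using h by (metis abs_le_square_iff abs_of_pos)
    hence "4 * a * c \<le> 2 * m" using h(4) reduced_form_bound[OF R] zero_le_power2[of a] by linarith
    moreover have "c \<le> a * c" using h by (simp add: mult_le_cancel_right1)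
    ultimately have "c \<le> 2 * m" using h by linarith
    with h am show "fst (a, b, c) \<in> {0..m} \<and> fst (snd (a, b, c)) \<in> {-m..m} \<and> snd (snd (a, b, c)) \<in> {0..2*m}"
      by auto
  qed
qed auto

lemma form_classes_subset:
  "pos_def_forms (- m) // bqf_equiv \<subseteq> (\<lambda>R. bqf_equiv `` {R}) ` reduced_forms m"
proof
  fix C assume "C \<in> pos_def_forms (- m) // bqf_equiv"
  then obtain Q where Q: "Q \<in> pos_def_forms (- m)" "C = bqf_equiv `` {Q}"
    by (auto elim: quotientE)
  obtain R where R: "R \<in> reduced_forms m" "(Q, R) \<in> bqf_equiv"
    using bqf_equiv_reduced[OF Q(1)] by blast
  have "C = bqf_equiv `` {R}" using equiv_class_eq[OF equiv_bqf_equiv R(2)] Q(2) by simp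
  with R(1) show "C \<in> (\<lambda>R. bqf_equiv `` {R}) ` reduced_forms m" by blast
qed

lemma finite_form_classes: "finite (pos_def_forms (- m) // bqf_equiv)"
  using form_classes_subset finite_reduced_forms by (meson finite_imageI finite_subset)

lemma class_weight_bounds: "1 / 3 \<le> class_weight C" "class_weight C \<le> 1"
  by (auto simp: class_weight_def)

lemma weighted_class_number_nonneg: "0 \<le> weighted_class_number D"
  unfolding weighted_class_number_def
  by (intro sum_nonneg order_trans[OF _ class_weight_bounds(1)]) auto

text \<open>Every class has a reduced representative and weighs at most 1. Forms with
  \<open>\<bar>b\<bar> = a\<close> or \<open>a = c\<close> are not normalised, so a class may be
  counted more than once, which only enlarges the right-hand side.\<close>

lemma weighted_class_number_le_card_reduced:
  "weighted_class_number (- m) \<le> real (card (reduced_forms m))"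
proof -
  have "weighted_class_number (- m) \<le> (\<Sum>C \<in> pos_def_forms (- m) // bqf_equiv. 1)"
    unfolding weighted_class_number_def by (intro sum_mono class_weight_bounds)
  also have "\<dots> = real (card (pos_def_forms (- m) // bqf_equiv))" by simp
  also have "\<dots> \<le> real (card (reduced_forms m))"
    using surj_card_le[OF finite_reduced_forms form_classes_subset] by simp
  finally show ?thesis .
qed

section \<open>Inequivalence of distinct strictly reduced forms\<close>

lemma strictly_reduced_eval_ge:
  fixes a b c x y :: int
  assumes "\<bar>b\<bar> \<le> a" "a < c" "y \<noteq> 0"
  shows "c \<le> a * x\<^sup>2 + b * x * y + c * y\<^sup>2"
proof -
  define u v where "u = \<bar>x\<bar>" and "v = \<bar>y\<bar>"
  have uv: "0 \<le> u" "1 \<le> v" "x\<^sup>2 = u * u" "y\<^sup>2 = v * v"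
    using assms by (auto simp: u_def v_def power2_eq_square)
  have a0: "0 \<le> a" using assms by linarith
  have "\<bar>b * x * y\<bar> = \<bar>b\<bar> * (u * v)" by (simp add: u_def v_def abs_mult)
  also have "\<dots> \<le> a * (u * v)" using assms uv by (intro mult_right_mono) auto
  finally have low: "a * x\<^sup>2 + b * x * y + c * y\<^sup>2 \<ge> a * (u * u) - a * (u * v) + c * (v * v)"
    unfolding uv by linarith
  have cv: "c * 1 \<le> c * v" using assms a0 uv by (intro mult_left_mono) auto
  have cvv: "c * v * 1 \<le> c * v * v" using assms a0 uv by (intro mult_left_mono) auto
  \<comment> \<open>If \<open>u \<ge> v\<close>, the first two terms add up to
    \<open>a u (u - v) \<ge> 0\<close>. Otherwise \<open>a u v \<le> c u v\<close>, and what remains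
    is at least \<open>c v (v - u) \<ge> c v\<close>.\<close>
  have "c \<le> a * (u * u) - a * (u * v) + c * (v * v)"
  proof (cases "u \<ge> v")
    case True
    have "0 \<le> a * u * (u - v)" using a0 uv True by simp
    hence "0 \<le> a * (u * u) - a * (u * v)" by (simp add: algebra_simps)
    moreover have "c \<le> c * (v * v)" using cv cvv by (simp add: mult.assoc)
    ultimately show ?thesis by linarith
  next
    case False
    have "a * (u * v) \<le> c * (u * v)" using assms uv by (intro mult_right_mono) auto
    moreover have "c * v * 1 \<le> c * v * (v - u)"
      using assms a0 uv False by (intro mult_left_mono) auto
    hence "c * v \<le> c * (v * v) - c * (u * v)" by (simp add: algebra_simps)
    moreover have "0 \<le> a * (u * u)" using a0 by simp
    ultimately show ?thesis using cv by linarith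
  qed
  with low show ?thesis by linarith
qed

text \<open>The coefficient \<open>a'\<close> is the value of the first form at
  \<open>(p, r)\<close>, which is at least \<open>c > a\<close> unless \<open>r = 0\<close>; by
  symmetry the leading coefficients agree and \<open>r = 0\<close>. The substitution is then a
  translation up to sign, so it moves \<open>b\<close> by a multiple of \<open>2 * a\<close>, and
  the half-open range leaves only \<open>b' = b\<close>.\<close>

lemma strictly_reduced_equiv_imp_eq:
  assumes "((a, b, c), (a', b', c')) \<in> bqf_equiv"
    and "- a < b" "b \<le> a" "a < c" and "- a' < b'" "b' \<le> a'" "a' < c'"
  shows "(a, b, c) = (a', b', c')"
proof -
  have fst_le: "a \<le> a'"
    if e: "((a, b, c), (a', b', c')) \<in> bqf_equiv" and "- a < b" "b \<le> a" "a < c"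
    for a b c a' b' c' :: int
  proof -
    obtain p q r s where *: "p * s - q * r = 1" "a' = a * p\<^sup>2 + b * p * r + c * r\<^sup>2"
      using e by (auto simp: bqf_equiv_iff)
    show ?thesis
    proof (cases "r = 0")
      case True
      hence "p \<noteq> 0" using * by auto
      hence "1 \<le> p\<^sup>2" by (simp add: int_one_le_iff_zero_less)
      hence "a * 1 \<le> a * p\<^sup>2" using that by (intro mult_left_mono) auto
      thus ?thesis using * True by simp
    next
      case False
      have "c \<le> a'" unfolding * using that False by (intro strictly_reduced_eval_ge) auto
      thus ?thesis using that by linarith
    qed
  qed
  have sym: "((a', b', c'), (a, b, c)) \<in> bqf_equiv"
    using assms(1) equiv_bqf_equiv by (meson equiv_def symD)
  have aa: "a = a'" using fst_le[OF assms(1-4)] fst_le[OF sym assms(5-7)] by linarith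
  obtain p q r s where *: "p * s - q * r = 1" "a' = a * p\<^sup>2 + b * p * r + c * r\<^sup>2"
        "b' = 2 * a * p * q + b * (p * s + q * r) + 2 * c * r * s"
    using assms(1) by (auto simp: bqf_equiv_iff)
  have r0: "r = 0"
  proof (rule ccontr)
    assume "r \<noteq> 0"
    hence "c \<le> a'" unfolding * using assms by (intro strictly_reduced_eval_ge) auto
    thus False using aa assms by linarith
  qed
  have "b' - b = 2 * a * (p * q)" using *(1,3) r0 by (simp add: algebra_simps)
  moreover have "\<bar>b' - b\<bar> < 2 * a" using assms aa by linarith
  ultimately have bb: "b' = b"
    using dvd_imp_le_int[of "b' - b" "2 * a"] by (metis abs_ge_self dvd_triv_left eq_iff_diff_eq_0 leD order_trans)
  have "b'\<^sup>2 - 4 * a' * c' = b\<^sup>2 - 4 * a * c" using bqf_disc_equiv[OF assms(1)] by simp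
  hence "c = c'" using aa bb assms by simp
  with aa bb show ?thesis by simp
qed

text \<open>Strictly reduced forms lie in distinct classes, and each class weighs at least
  1/3.\<close>

lemma card_strictly_reduced_le_weighted_class_number:
  assumes F: "\<And>a b c. (a, b, c) \<in> F \<Longrightarrow> - a < b \<and> b \<le> a \<and> a < c \<and> 4 * a * c - b\<^sup>2 = m"
  shows "real (card F) / 3 \<le> weighted_class_number (- m)"
proof -
  let ?cl = "\<lambda>R. bqf_equiv `` {R}"
  have pd: "F \<subseteq> pos_def_forms (- m)"
  proof
    fix Q assume "Q \<in> F"
    obtain a b c where Q: "Q = (a, b, c)" by (metis prod.exhaust)
    have h: "- a < b" "b \<le> a" "a < c" "4 * a * c - b\<^sup>2 = m" using F \<open>Q \<in> F\<close> Q by auto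
    have "bqf_eval Q x y > 0" if "(x, y) \<noteq> (0, 0)" for x y
    proof (cases "y = 0")
      case True
      with that h show ?thesis by (simp add: Q)
    next
      case False
      have "c \<le> a * x\<^sup>2 + b * x * y + c * y\<^sup>2"
        using h False by (intro strictly_reduced_eval_ge) auto
      with h show ?thesis by (simp add: Q)
    qed
    with h show "Q \<in> pos_def_forms (- m)" by (simp add: pos_def_forms_def bqf_pos_def_def Q)
  qed
  have inj: "inj_on ?cl F"
  proof (rule inj_onI)
    fix Q R assume QR: "Q \<in> F" "R \<in> F" "?cl Q = ?cl R"
    hence e: "(Q, R) \<in> bqf_equiv" using eq_equiv_class[OF _ equiv_bqf_equiv] by blast
    obtain a b c a' b' c' where [simp]: "Q = (a, b, c)" "R = (a', b', c')"
      by (metis prod.exhaust)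
    show "Q = R" using F[of a b c] F[of a' b' c'] QR e strictly_reduced_equiv_imp_eq[of a b c a' b' c']
      by auto
  qed
  have sub: "?cl ` F \<subseteq> pos_def_forms (- m) // bqf_equiv"
    using pd by (auto intro: quotientI)
  have "real (card F) / 3 = (\<Sum>C \<in> ?cl ` F. 1 / 3)" using inj by (simp add: card_image)
  also have "\<dots> \<le> (\<Sum>C \<in> ?cl ` F. class_weight C)" by (intro sum_mono class_weight_bounds)
  also have "\<dots> \<le> weighted_class_number (- m)"
    unfolding weighted_class_number_def
    by (intro sum_mono2 finite_form_classes sub order_trans[OF _ class_weight_bounds(1)]) auto
  finally show ?thesis .
qed

section \<open>Sums of reciprocals of divisors\<close>

text \<open>The function sigma_{-1}, that is, the sum of the divisors of \<open>k\<close> divided by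
  \<open>k\<close>. At \<open>k = 0\<close> the index set is infinite and the value is 0.\<close>

definition inv_divisor_sum :: "nat \<Rightarrow> real" where
  "inv_divisor_sum k = (\<Sum>d | d dvd k. 1 / real d)"

lemma inv_divisor_sum_mono:
  assumes "k dvd l" "l > 0"
  shows "inv_divisor_sum k \<le> inv_divisor_sum l"
  unfolding inv_divisor_sum_def
  using assms by (intro sum_mono2) (auto intro: dvd_trans)

lemma inv_divisor_sum_nonneg: "inv_divisor_sum k \<ge> 0"
  by (simp add: inv_divisor_sum_def sum_nonneg)

text \<open>The difference \<open>harm n - ln n\<close> decreases from its value 1 at
  \<open>n = 1\<close>.\<close>

lemma harmonic_sum_le:
  assumes "n > 0"
  shows "(\<Sum>d=1..n. 1 / real d) \<le> 1 + ln (real n)"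
proof -
  obtain k where n: "n = Suc k" using assms gr0_implies_Suc by blast
  have "harm (Suc k) - ln (real (Suc k)) \<le> harm (Suc 0) - ln (real (Suc 0))"
    using decseq_harm_diff_ln by (rule decseqD) simp
  thus ?thesis by (simp add: n harm_def inverse_eq_divide)
qed

section \<open>Logarithmic sums over prime divisors\<close>

lemma ln_eq_sum_multiplicity:
  assumes "n > 0"
  shows "ln (real n) = (\<Sum>p\<in>prime_factors n. real (multiplicity p n) * ln (real p))"
proof -
  have "real n = real (\<Prod>p\<in>prime_factors n. p ^ multiplicity p n)"
    using prime_factorization_nat[OF assms] by simp
  hence "real n = (\<Prod>p\<in>prime_factors n. real p ^ multiplicity p n)" by simp
  moreover have "ln (\<Prod>p\<in>prime_factors n. real p ^ multiplicity p n) =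
      (\<Sum>p\<in>prime_factors n. ln (real p ^ multiplicity p n))"
    by (rule ln_prod) (auto simp: in_prime_factors_iff prime_gt_0_nat)
  moreover have "\<dots> = (\<Sum>p\<in>prime_factors n. real (multiplicity p n) * ln (real p))"
    by (intro sum.cong refl ln_realpow)
  ultimately show ?thesis by metis
qed

lemma sum_ln_prime_factors_le:
  assumes "n > 0"
  shows "(\<Sum>p\<in>prime_factors n. ln (real p)) \<le> ln (real n)"
  unfolding ln_eq_sum_multiplicity[OF assms]
proof (rule sum_mono)
  fix p assume p: "p \<in> prime_factors n"
  hence "multiplicity p n \<ge> 1" by (auto simp: prime_factors_multiplicity)
  moreover have "ln (real p) \<ge> 0"
    using p by (intro ln_ge_zero) (auto simp: in_prime_factors_iff dest!: prime_ge_1_nat)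
  ultimately
  show "ln (real p) \<le> real (multiplicity p n) * ln (real p)"
    by (simp add: mult_le_cancel_right1)
qed

text \<open>Counting the prime divisors of \<open>y!\<close> gives this weak form of Mertens' theorem.\<close>

lemma sum_ln_prime_over_prime_le:
  assumes "y > 0"
  shows "(\<Sum>p | prime p \<and> p \<le> y. ln (real p) / real p) \<le> 2 * ln (real y)"
proof -
  let ?P = "{p. prime p \<and> p \<le> y}"
  have fin: "finite ?P" by (rule finite_subset[of _ "{..y}"]) auto
  have "(\<Sum>p\<in>?P. ln (real p) * real (card {i\<in>{1..y}. p dvd i})) =
        (\<Sum>p\<in>?P. \<Sum>i\<in>{1..y}. if p dvd i then ln (real p) else 0)"
    by (intro sum.cong refl) (simp add: sum.If_cases Int_def mult.commute)
  also have "\<dots> = (\<Sum>i\<in>{1..y}. \<Sum>p\<in>?P. if p dvd i then ln (real p) else 0)"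
    by (rule sum.swap)
  also have "\<dots> \<le> (\<Sum>i\<in>{1..y}. ln (real y))"
  proof (rule sum_mono)
    fix i assume i: "i \<in> {1..y}"
    have "p \<le> y" if "p dvd i" for p
      using dvd_imp_le[OF that] i by auto
    hence "(\<Sum>p\<in>?P. if p dvd i then ln (real p) else 0) = (\<Sum>p\<in>prime_factors i. ln (real p))"
      using i fin by (intro sum.mono_neutral_cong_right)
        (auto simp: in_prime_factors_iff)
    also have "\<dots> \<le> ln (real i)" using i by (intro sum_ln_prime_factors_le) auto
    also have "\<dots> \<le> ln (real y)" using i by simp
    finally show "(\<Sum>p\<in>?P. if p dvd i then ln (real p) else 0) \<le> ln (real y)" .
  qed
  also have "\<dots> = real y * ln (real y)" by simp
  finally have le: "(\<Sum>p\<in>?P. ln (real p) * real (card {i\<in>{1..y}. p dvd i})) \<le> real y * ln (real y)" .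
  \<comment> \<open>Since \<open>p \<le> y\<close>, the integer \<open>y div p\<close> is at least 1
    and so exceeds half of \<open>y / p\<close>; this is the source of the factor 2.\<close>
  have "(\<Sum>p\<in>?P. real y / 2 * (ln (real p) / real p)) \<le>
        (\<Sum>p\<in>?P. ln (real p) * real (card {i\<in>{1..y}. p dvd i}))"
  proof (rule sum_mono)
    fix p assume "p \<in> ?P"
    hence p: "prime p" "p \<le> y" "p > 0" by (auto simp: prime_gt_0_nat)
    have "(\<lambda>j. p * j) ` {1..y div p} \<subseteq> {i\<in>{1..y}. p dvd i}"
      using p by (auto simp: less_eq_div_iff_mult_less_eq mult.commute)
    hence "card ((\<lambda>j. p * j) ` {1..y div p}) \<le> card {i\<in>{1..y}. p dvd i}"
      by (intro card_mono) auto
    hence c: "y div p \<le> card {i\<in>{1..y}. p dvd i}"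
      using p by (simp add: card_image inj_on_def)
    have "y div p \<ge> 1" using p by (simp add: div_greater_zero_iff Suc_le_eq)
    moreover have "y < p * (y div p) + p"
      using p by (metis add.commute add_less_cancel_left mod_less_divisor mult_div_mod_eq)
    ultimately have "y < p * (y div p) + p * (y div p)"
      using p by (metis add_le_mono le_refl less_le_trans mult.right_neutral mult_le_mono2)
    hence "real y \<le> 2 * (real p * real (y div p))"
      by (metis less_imp_le mult_2 of_nat_add of_nat_le_iff of_nat_mult)
    hence "real y / 2 / real p \<le> real (y div p)" using p by (simp add: field_simps)
    also have "\<dots> \<le> real (card {i\<in>{1..y}. p dvd i})" using c by simp
    finally have "ln (real p) * (real y / 2 / real p) \<le> ln (real p) * real (card {i\<in>{1..y}. p dvd i})"
      using p by (intro mult_left_mono) (auto intro!: ln_ge_zero)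
    thus "real y / 2 * (ln (real p) / real p) \<le> ln (real p) * real (card {i\<in>{1..y}. p dvd i})"
      by (simp add: mult.commute)
  qed
  with le have "real y / 2 * (\<Sum>p\<in>?P. ln (real p) / real p) \<le> real y / 2 * (2 * ln (real y))"
    by (simp add: sum_distrib_left)
  thus ?thesis using assms by (subst (asm) mult_le_cancel_left_pos) auto
qed

text \<open>Primes up to \<open>y\<close> are covered by the Mertens bound. For the larger ones
  \<open>1 / p \<le> 1 / y\<close>, while their logarithms add up to at most
  \<open>ln k \<le> y\<close>, so together they contribute at most 1.\<close>

lemma sum_ln_over_prime_factors_le:
  assumes "k > 0" "y > 0" "ln (real k) \<le> real y"
  shows "(\<Sum>p\<in>prime_factors k. ln (real p) / real p) \<le> 2 * ln (real y) + 1"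
proof -
  let ?A = "{p \<in> prime_factors k. p \<le> y}" and ?B = "{p \<in> prime_factors k. \<not> p \<le> y}"
  have "(\<Sum>p\<in>prime_factors k. ln (real p) / real p) =
        (\<Sum>p\<in>?A. ln (real p) / real p) + (\<Sum>p\<in>?B. ln (real p) / real p)"
    by (subst sum.union_disjoint[symmetric]) (auto intro!: sum.cong)
  also have "(\<Sum>p\<in>?A. ln (real p) / real p) \<le> (\<Sum>p | prime p \<and> p \<le> y. ln (real p) / real p)"
    by (rule sum_mono2)
       (auto simp: in_prime_factors_iff prime_ge_1_nat intro!: divide_nonneg_nonneg ln_ge_zero
         intro: finite_subset[of _ "{..y}"] prime_ge_1_nat[simplified])
  also have "\<dots> \<le> 2 * ln (real y)" by (rule sum_ln_prime_over_prime_le[OF assms(2)])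
  also have "(\<Sum>p\<in>?B. ln (real p) / real p) \<le> (\<Sum>p\<in>?B. ln (real p) / real y)"
    using assms(2) by (intro sum_mono divide_left_mono)
      (auto simp: in_prime_factors_iff prime_ge_1_nat intro!: ln_ge_zero mult_pos_pos)
  also have "\<dots> = (\<Sum>p\<in>?B. ln (real p)) / real y" by (simp add: sum_divide_distrib)
  also have "(\<Sum>p\<in>?B. ln (real p)) \<le> (\<Sum>p\<in>prime_factors k. ln (real p))"
    by (intro sum_mono2) (auto simp: in_prime_factors_iff prime_ge_1_nat intro!: ln_ge_zero)
  also have "\<dots> \<le> ln (real k)" by (rule sum_ln_prime_factors_le[OF assms(1)])
  also have "ln (real k) / real y \<le> 1" using assms by simp
  finally show ?thesis using assms(2) by (simp add: divide_right_mono)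
qed

section \<open>The logarithmic bound for \<open>inv_divisor_sum\<close>\<close>

lemma sum_inverse_multiples_le:
  assumes "k > 0" "q > 0"
  shows "(\<Sum>d | d dvd k \<and> q dvd d. 1 / real d) \<le> inv_divisor_sum k / real q"
proof -
  have fin: "finite {d. d dvd k}" using assms by simp
  have sub: "{d. d dvd k \<and> q dvd d} \<subseteq> (\<lambda>e. q * e) ` {d. d dvd k}"
    by (auto elim!: dvdE)
  have "(\<Sum>d | d dvd k \<and> q dvd d. 1 / real d) \<le> (\<Sum>d\<in>(\<lambda>e. q * e) ` {d. d dvd k}. 1 / real d)"
    by (intro sum_mono2 sub) (use fin in auto)
  also have "\<dots> = (\<Sum>e | e dvd k. 1 / real (q * e))"
    using assms by (subst sum.reindex) (auto simp: inj_on_def)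
  also have "\<dots> = inv_divisor_sum k / real q"
    by (simp add: inv_divisor_sum_def sum_divide_distrib mult.commute)
  finally show ?thesis .
qed

text \<open>The multiplicity counts the \<open>j \<ge> 1\<close> with \<open>p ^ j dvd d\<close>.
  Exchanging the sums, each \<open>j\<close> contributes at most
  \<open>inv_divisor_sum k / p ^ j\<close>, and the geometric series is at most
  \<open>2 / p\<close>.\<close>

lemma sum_multiplicity_over_divisors_le:
  assumes "k > 0" "prime p"
  shows "(\<Sum>d | d dvd k. real (multiplicity p d) / real d) \<le> 2 / real p * inv_divisor_sum k"
proof -
  have p: "p \<ge> 2" using assms by (simp add: prime_ge_2_nat)
  have fin: "finite {d. d dvd k}" using assms by simp
  let ?J = "multiplicity p k"
  have S0: "inv_divisor_sum k \<ge> 0" by (rule inv_divisor_sum_nonneg)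
  have "(\<Sum>d | d dvd k. real (multiplicity p d) / real d) =
        (\<Sum>d | d dvd k. \<Sum>j\<in>{1..?J}. if p ^ j dvd d then 1 / real d else 0)"
  proof (rule sum.cong[OF refl])
    fix d assume "d \<in> {d. d dvd k}"
    hence d: "d dvd k" "d \<noteq> 0" using assms by auto
    have le: "multiplicity p d \<le> ?J" using d assms by (simp add: dvd_imp_multiplicity_le)
    have "(\<Sum>j\<in>{1..?J}. if p ^ j dvd d then 1 / real d else 0) =
          real (card {j\<in>{1..?J}. p ^ j dvd d}) / real d"
      by (simp add: sum.If_cases Int_def)
    also have "{j\<in>{1..?J}. p ^ j dvd d} = {1..multiplicity p d}"
      using d assms le p by (auto simp: power_dvd_iff_le_multiplicity)
    finally show "real (multiplicity p d) / real d = (\<Sum>j\<in>{1..?J}. if p ^ j dvd d then 1 / real d else 0)"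
      by simp
  qed
  also have "\<dots> = (\<Sum>j\<in>{1..?J}. \<Sum>d | d dvd k. if p ^ j dvd d then 1 / real d else 0)"
    by (rule sum.swap)
  also have "\<dots> = (\<Sum>j\<in>{1..?J}. \<Sum>d | d dvd k \<and> p ^ j dvd d. 1 / real d)"
    using fin by (simp add: sum.inter_filter[symmetric] conj_commute)
  also have "\<dots> \<le> (\<Sum>j\<in>{1..?J}. inv_divisor_sum k / real (p ^ j))"
    using assms p by (intro sum_mono sum_inverse_multiples_le) auto
  also have "\<dots> = inv_divisor_sum k * (\<Sum>j\<in>{1..?J}. (1 / real p) ^ j)"
    by (simp add: sum_distrib_left power_one_over field_simps)
  also have "(\<Sum>j\<in>{1..?J}. (1 / real p) ^ j) \<le> 2 / real p"
  proof -
    \<comment> \<open>The remainder term makes the induction work; the inductive step is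
      \<open>2 / p \<le> 1\<close>.\<close>
    have "(\<Sum>j\<in>{1..n}. (1 / real p) ^ j) \<le> 2 / real p - 2 * (1 / real p) ^ Suc n" for n
    proof (induction n)
      case (Suc n)
      have "(1 / real p) ^ Suc n * (2 * (1 / real p)) \<le> (1 / real p) ^ Suc n * 1"
        using p by (intro mult_left_mono) auto
      with Suc show ?case by simp
    qed simp
    from this[of ?J] show ?thesis by (rule order_trans) simp
  qed
  finally have "(\<Sum>d | d dvd k. real (multiplicity p d) / real d) \<le> inv_divisor_sum k * (2 / real p)"
    using S0 by (simp only: mult_left_mono)
  thus ?thesis by (simp add: mult.commute)
qed

text \<open>
  The logarithm of a divisor \<open>d\<close> of \<open>k\<close>, weighted by \<open>1 / d\<close>, has mean at most
  \<open>L = (\<Sum>p | k. 2 ln p / p)\<close>; so by Markov's inequality the divisors up to \<open>exp (2 L)\<close>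
  carry at least half of the total weight.
\<close>

lemma inv_divisor_sum_le:
  assumes "k > 0" "y > 0" "ln (real k) \<le> real y"
  shows "inv_divisor_sum k \<le> 10 + 16 * ln (real y)"
proof -
  have fin: "finite {d. d dvd k}" using assms by simp
  define S where "S = inv_divisor_sum k"
  define L where "L = (\<Sum>p\<in>prime_factors k. 2 * ln (real p) / real p)"
  have L_le: "L \<le> 2 * (2 * ln (real y) + 1)"
    using sum_ln_over_prime_factors_le[OF assms] by (simp add: L_def sum_distrib_left[symmetric] flip: times_divide_eq_right)
  have L0: "L \<ge> 0" unfolding L_def
    by (intro sum_nonneg divide_nonneg_nonneg mult_nonneg_nonneg ln_ge_zero) (auto simp: in_prime_factors_iff prime_ge_1_nat)
  have "(\<Sum>d | d dvd k. ln (real d) / real d) =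
        (\<Sum>d | d dvd k. \<Sum>p\<in>prime_factors k. ln (real p) * (real (multiplicity p d) / real d))"
  proof (rule sum.cong[OF refl])
    fix d assume "d \<in> {d. d dvd k}"
    hence d: "d dvd k" "d > 0" using assms by (auto intro: Nat.gr0I)
    have "(\<Sum>p\<in>prime_factors d. real (multiplicity p d) * ln (real p)) =
          (\<Sum>p\<in>prime_factors k. real (multiplicity p d) * ln (real p))"
      using d assms by (intro sum.mono_neutral_left)
        (auto simp: in_prime_factors_iff not_dvd_imp_multiplicity_0 intro: dvd_trans)
    thus "ln (real d) / real d = (\<Sum>p\<in>prime_factors k. ln (real p) * (real (multiplicity p d) / real d))"
      by (simp add: ln_eq_sum_multiplicity[OF d(2)] sum_divide_distrib mult.commute)
  qed
  also have "\<dots> = (\<Sum>p\<in>prime_factors k. ln (real p) * (\<Sum>d | d dvd k. real (multiplicity p d) / real d))"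
    by (subst sum.swap) (simp add: sum_distrib_left)
  also have "\<dots> \<le> (\<Sum>p\<in>prime_factors k. ln (real p) * (2 / real p * S))"
    unfolding S_def using assms
    by (intro sum_mono mult_left_mono sum_multiplicity_over_divisors_le)
       (auto simp: in_prime_factors_iff prime_ge_1_nat intro!: ln_ge_zero)
  also have "\<dots> = L * S" unfolding L_def sum_distrib_right by (intro sum.cong) (auto simp: field_simps)
  finally have T_le: "(\<Sum>d | d dvd k. ln (real d) / real d) \<le> L * S" .
  have ge0: "ln (real d) / real d \<ge> 0" for d :: nat
    by (cases "d = 0") auto
  \<comment> \<open>Markov's inequality divides by \<open>2 * L\<close>, so the case
    \<open>L = 0\<close>, which forces \<open>k = 1\<close>, is treated apart.\<close>
  have "S \<le> 2 * (1 + 2 * L)"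
  proof (cases "L = 0")
    case True
    have "(\<Sum>d | d dvd k. ln (real d) / real d) = 0"
      using T_le True ge0 by (intro antisym sum_nonneg) auto
    hence "\<forall>d\<in>{d. d dvd k}. ln (real d) / real d = 0"
      using fin ge0 by (subst (asm) sum_nonneg_eq_0_iff) auto
    hence "ln (real k) / real k = 0" by (rule bspec) simp
    hence "k = 1" using assms by simp
    thus ?thesis by (simp add: S_def inv_divisor_sum_def True)
  next
    case False
    define Z where "Z = nat \<lfloor>exp (2 * L)\<rfloor>"
    have Z1: "Z \<ge> 1" unfolding Z_def using L0 by (simp add: le_nat_iff le_floor_iff)
    have Zle: "real Z \<le> exp (2 * L)" unfolding Z_def by simp
    let ?A = "{d \<in> {d. d dvd k}. d \<le> Z}" and ?B = "{d \<in> {d. d dvd k}. \<not> d \<le> Z}"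
    have "S = (\<Sum>d\<in>?A. 1 / real d) + (\<Sum>d\<in>?B. 1 / real d)"
      unfolding S_def inv_divisor_sum_def using fin
      by (subst sum.union_disjoint[symmetric]) (auto intro!: sum.cong)
    also have "(\<Sum>d\<in>?A. 1 / real d) \<le> (\<Sum>d=1..Z. 1 / real d)"
      using assms by (intro sum_mono2) (auto intro: Nat.gr0I simp: Suc_le_eq)
    also have "\<dots> \<le> 1 + ln (real Z)" using Z1 by (intro harmonic_sum_le) auto
    also have "ln (real Z) \<le> 2 * L" using Zle Z1 by (metis ln_exp ln_le_cancel_iff exp_gt_zero of_nat_0_less_iff less_le_trans zero_less_one)
    also have "(\<Sum>d\<in>?B. 1 / real d) \<le> (\<Sum>d\<in>?B. ln (real d) / real d / (2 * L))"
    proof (rule sum_mono)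
      fix d assume "d \<in> ?B"
      hence "d > Z" by auto
      hence d: "real d > exp (2 * L)" unfolding Z_def by linarith
      hence "real d > 0" by (rule less_trans[OF exp_gt_zero])
      moreover from this d have "2 * L < ln (real d)" by (simp add: ln_less_cancel_iff[symmetric] del: ln_less_cancel_iff)
      ultimately
      have "1 / real d \<le> ln (real d) / real d / (2 * L)" using L0 False by (simp add: field_simps)
      thus "1 / real d \<le> ln (real d) / real d / (2 * L)" .
    qed
    also have "\<dots> = (\<Sum>d\<in>?B. ln (real d) / real d) / (2 * L)" by (simp add: sum_divide_distrib)
    also have "(\<Sum>d\<in>?B. ln (real d) / real d) \<le> (\<Sum>d | d dvd k. ln (real d) / real d)"
      using fin by (intro sum_mono2 ge0) auto
    also have "\<dots> \<le> L * S" by (rule T_le)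
    \<comment> \<open>The divisors beyond the cutoff carry at most \<open>S / 2\<close>; absorbing
      this on the left doubles the harmonic part.\<close>
    finally have "S \<le> 1 + 2 * L + L * S / (2 * L)" using L0 by (simp add: divide_right_mono)
    thus ?thesis using False by (simp add: field_simps)
  qed
  also have "\<dots> \<le> 2 * (1 + 2 * (2 * (2 * ln (real y) + 1)))" using L_le by simp
  finally show ?thesis by (simp add: S_def)
qed

section \<open>The upper bound for the class number\<close>

text \<open>Congruent numbers are separated by their quotients by \<open>l\<close>, and these lie in
  \<open>{- h..h}\<close>.\<close>

lemma card_congruent_in_interval_le:
  fixes X :: "int set" and l h :: nat
  assumes "l > 0" "X \<subseteq> {- int (l * h)..int (l * h)}" "\<And>x y. x \<in> X \<Longrightarrow> y \<in> X \<Longrightarrow> int l dvd x - y"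
  shows "card X \<le> 2 * h + 1"
proof -
  have inj: "inj_on (\<lambda>x. x div int l) X"
  proof (rule inj_onI)
    fix x y assume xy: "x \<in> X" "y \<in> X" "x div int l = y div int l"
    have "x mod int l = y mod int l" using assms(3)[OF xy(1,2)] by (simp add: mod_eq_dvd_iff)
    with xy(3) show "x = y" by (metis div_mult_mod_eq)
  qed
  have "(\<lambda>x. x div int l) ` X \<subseteq> {- int h..int h}"
  proof safe
    fix x assume "x \<in> X"
    hence x: "- int (l * h) \<le> x" "x \<le> int (l * h)" using assms(2) by auto
    have "(int l * (- int h)) div int l \<le> x div int l"
      using x assms(1) by (intro zdiv_mono1) auto
    moreover have "x div int l \<le> (int l * int h) div int l"
      using x assms(1) by (intro zdiv_mono1) auto
    ultimately show "x div int l \<in> {- int h..int h}"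
      using assms(1) by (simp del: mult_minus_right)
  qed
  hence "card ((\<lambda>x. x div int l) ` X) \<le> card {- int h..int h}" by (intro card_mono) auto
  thus ?thesis using inj by (simp add: card_image)
qed

text \<open>
  Fix one root \<open>b\<^sub>0\<close>. Any other root \<open>b\<close> satisfies \<open>(b - b\<^sub>0) (b + b\<^sub>0) \<equiv> 0\<close> modulo \<open>a\<close>,
  so for some factorisation \<open>a = d e\<close> it lies in a single residue class modulo \<open>lcm d e\<close>.
\<close>

lemma card_roots_le:
  fixes a m :: nat
  assumes "a > 0"
  shows "card {b::int. \<bar>b\<bar> \<le> int a \<and> int a dvd b\<^sup>2 + int m} \<le>
    3 * (\<Sum>d | d dvd a \<and> (gcd d (a div d))\<^sup>2 dvd 4 * m. gcd d (a div d))"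
proof -
  define B where "B = {b::int. \<bar>b\<bar> \<le> int a \<and> int a dvd b\<^sup>2 + int m}"
  define E where "E = {d. d dvd a \<and> (gcd d (a div d))\<^sup>2 dvd 4 * m}"
  have finE: "finite E" unfolding E_def using assms by simp
  show ?thesis
  proof (cases "B = {}")
    case False
    then obtain b0 where b0: "b0 \<in> B" by blast
    define X where "X d = {b. \<bar>b\<bar> \<le> int a \<and> int d dvd b - b0 \<and> int (a div d) dvd b + b0}" for d
    have sub: "B \<subseteq> (\<Union>d\<in>E. X d)"
    proof
      fix b assume b: "b \<in> B"
      \<comment> \<open>With the full gcd as \<open>d\<close>, the cofactor \<open>e\<close> is
        coprime to \<open>(b - b0) / d\<close> and must therefore divide
        \<open>b + b0\<close>.\<close>
      define d where "d = nat (gcd (int a) (b - b0))"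
      define e where "e = a div d"
      define h where "h = gcd d e"
      have dint: "int d = gcd (int a) (b - b0)" by (simp add: d_def)
      have da: "d dvd a" by (metis dint gcd_dvd1 int_dvd_int_iff)
      have dpos: "d > 0" using assms da by (auto intro: Nat.gr0I)
      have ade: "a = d * e" using da by (simp add: e_def)
      obtain w where w: "b - b0 = int d * w" by (metis dint gcd_dvd2 dvdE)
      have cop: "coprime (int e) w"
      proof -
        have "int d * gcd (int e) w = gcd (int a) (b - b0)"
          unfolding w ade by (simp add: gcd_mult_left)
        hence "int d * gcd (int e) w = int d * 1" using dint by simp
        hence "gcd (int e) w = 1" using dpos by simp
        thus ?thesis by (simp add: coprime_iff_gcd_eq_1)
      qed
      have "int a dvd (b\<^sup>2 + int m) - (b0\<^sup>2 + int m)"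
        using b b0 by (intro dvd_diff) (auto simp: B_def)
      also have "(b\<^sup>2 + int m) - (b0\<^sup>2 + int m) = (b - b0) * (b + b0)"
        by (simp add: power2_eq_square algebra_simps)
      finally have "int d * int e dvd int d * (w * (b + b0))" by (simp add: w ade mult.assoc)
      hence "int e dvd w * (b + b0)" using dpos by simp
      hence e: "int e dvd b + b0" using cop by (simp add: coprime_dvd_mult_right_iff)
      have dd: "int d dvd b - b0" using w by simp
      \<comment> \<open>A common divisor \<open>h\<close> of \<open>d\<close> and \<open>e\<close>
        divides the difference \<open>2 * b0\<close>; as \<open>h\<^sup>2\<close> also divides
        \<open>a\<close>, it divides \<open>4 * m\<close>. This is the membership condition of
        \<open>E\<close>.\<close>
      have "int h dvd int d" "int h dvd int e" by (simp_all add: h_def)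
      hence "int h dvd (b + b0) - (b - b0)" using e dd by (meson dvd_diff dvd_trans)
      hence "int h dvd 2 * b0" by simp
      hence "(int h)\<^sup>2 dvd (2 * b0)\<^sup>2" by (rule dvd_power_same)
      hence h1: "(int h)\<^sup>2 dvd 4 * b0\<^sup>2" by (simp add: power2_eq_square)
      have "(int h)\<^sup>2 dvd int a" unfolding ade power2_eq_square of_nat_mult
        by (intro mult_dvd_mono) (simp_all add: h_def)
      also have "int a dvd b0\<^sup>2 + int m" using b0 by (simp add: B_def)
      finally have "(int h)\<^sup>2 dvd 4 * (b0\<^sup>2 + int m)" by (rule dvd_mult)
      hence "(int h)\<^sup>2 dvd 4 * (b0\<^sup>2 + int m) - 4 * b0\<^sup>2" using h1 by (rule dvd_diff)
      hence "int (h\<^sup>2) dvd int (4 * m)" by simp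
      hence "h\<^sup>2 dvd 4 * m" by (simp only: int_dvd_int_iff)
      hence "d \<in> E" using da by (simp add: E_def h_def e_def)
      moreover have "b \<in> X d" using b dd e by (simp add: X_def B_def e_def)
      ultimately show "b \<in> (\<Union>d\<in>E. X d)" by blast
    qed
    have cardX: "card (X d) \<le> 3 * gcd d (a div d)" if "d \<in> E" for d
    proof -
      define e where "e = a div d"
      have ade: "a = d * e" using that by (simp add: E_def e_def)
      have pos: "d > 0" "e > 0" using assms ade by auto
      have lg: "lcm d e * gcd d e = a" by (metis ade prod_gcd_lcm_nat mult.commute)
      \<comment> \<open>The interval reaches to \<open>a = lcm d e * gcd d e\<close> on either side
        and the modulus is \<open>lcm d e\<close>.\<close>
      have "card (X d) \<le> 2 * gcd d e + 1"
      proof (rule card_congruent_in_interval_le[of "lcm d e"])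
        show "lcm d e > 0" using pos by (simp add: lcm_pos_nat)
        show "X d \<subseteq> {- int (lcm d e * gcd d e)..int (lcm d e * gcd d e)}"
          unfolding lg by (auto simp: X_def)
        fix x y assume "x \<in> X d" "y \<in> X d"
        hence xy: "int d dvd x - b0" "int d dvd y - b0" "int e dvd x + b0" "int e dvd y + b0"
          by (auto simp: X_def e_def)
        have "int d dvd x - y" using dvd_diff[OF xy(1,2)] by simp
        moreover have "int e dvd x - y" using dvd_diff[OF xy(3,4)] by simp
        ultimately have "lcm (int d) (int e) dvd x - y" by (rule lcm_least)
        thus "int (lcm d e) dvd x - y" by simp
      qed
      moreover have "gcd d e \<ge> 1" using pos by (simp add: Suc_le_eq)
      ultimately show ?thesis by (simp add: e_def)
    qed
    have finX: "finite (X d)" for d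
      by (rule finite_subset[of _ "{- int a..int a}"]) (auto simp: X_def)
    have "card B \<le> card (\<Union>d\<in>E. X d)" using sub finE finX by (intro card_mono) auto
    also have "\<dots> \<le> (\<Sum>d\<in>E. card (X d))" by (rule card_UN_le[OF finE])
    also have "\<dots> \<le> (\<Sum>d\<in>E. 3 * gcd d (a div d))" by (intro sum_mono cardX)
    finally show ?thesis by (simp add: B_def E_def sum_distrib_left)
  next
    case True
    thus ?thesis by (simp only: B_def card.empty)
  qed
qed

section \<open>Averaging the root count over the modulus\<close>

lemma factors_le:
  fixes d e Y :: nat
  assumes "0 < d" "0 < e" "d * e \<le> Y"
  shows "d \<le> Y" "e \<le> Y"
proof -
  have "d * 1 \<le> d * e" "1 * e \<le> d * e" by (rule mult_le_mono; use assms in simp)+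
  thus "d \<le> Y" "e \<le> Y" using assms by linarith+
qed

lemma finite_pairs_prod_le: "finite {(d, e). 0 < d \<and> 0 < e \<and> d * e \<le> (Y::nat)}"
  by (rule finite_subset[of _ "{..Y} \<times> {..Y}"]) (auto intro: factors_le)

lemma card_pairs_prod_le:
  "real (card {(d, e). d > 0 \<and> e > 0 \<and> d * e \<le> Y}) \<le> real Y * (1 + ln (real Y))"
proof (cases "Y = 0")
  case True
  hence "{(d, e). d > 0 \<and> e > 0 \<and> d * e \<le> Y} = {}" by auto
  thus ?thesis by (simp only: card.empty True)
next
  case False
  have "{(d, e). d > 0 \<and> e > 0 \<and> d * e \<le> Y} = Sigma {1..Y} (\<lambda>d. {1..Y div d})"
    by (auto simp: less_eq_div_iff_mult_less_eq mult.commute Suc_le_eq intro: factors_le)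
  hence "real (card {(d, e). d > 0 \<and> e > 0 \<and> d * e \<le> Y}) = (\<Sum>d=1..Y. real (Y div d))"
    by simp
  also have "\<dots> \<le> (\<Sum>d=1..Y. real Y * (1 / real d))"
    by (intro sum_mono) (simp add: of_nat_div_le_of_nat)
  also have "\<dots> = real Y * (\<Sum>d=1..Y. 1 / real d)" by (simp add: sum_distrib_left)
  also have "\<dots> \<le> real Y * (1 + ln (real Y))"
    using False by (intro mult_left_mono harmonic_sum_le) auto
  finally show ?thesis .
qed

text \<open>Dividing both entries by \<open>h\<close> gives pairs with product at most
  \<open>A div h\<^sup>2\<close>; that the quotients are coprime is given away.\<close>

lemma card_pairs_gcd_le:
  assumes "h > 0" "A > 0"
  shows "real (card {(d, e). d > 0 \<and> e > 0 \<and> d * e \<le> A \<and> gcd d e = h}) \<le>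
    real A / (real h)\<^sup>2 * (1 + ln (real A))"
proof -
  define Y where "Y = A div h\<^sup>2"
  let ?P = "{(d, e). d > 0 \<and> e > 0 \<and> d * e \<le> A \<and> gcd d e = h}"
  let ?Q = "{(d, e). d > 0 \<and> e > 0 \<and> d * e \<le> Y}"
  have finQ: "finite ?Q" by (rule finite_pairs_prod_le)
  have "?P \<subseteq> (\<lambda>(d, e). (h * d, h * e)) ` ?Q"
  proof
    fix z assume "z \<in> ?P"
    then obtain d e where z: "z = (d, e)" and de: "0 < d" "0 < e" "d * e \<le> A" "h = gcd d e" by auto
    obtain d' e' where *: "d = h * d'" "e = h * e'" by (metis de(4) gcd_dvd1 gcd_dvd2 dvdE)
    have "h\<^sup>2 * (d' * e') \<le> A" using de(3) unfolding * by (simp add: power2_eq_square mult_ac)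
    hence "d' * e' \<le> Y" unfolding Y_def using assms
      by (simp add: less_eq_div_iff_mult_less_eq mult.commute)
    moreover have "d' > 0" using de(1) unfolding *(1) by simp
    moreover have "e' > 0" using de(2) unfolding *(2) by simp
    ultimately have "(d', e') \<in> ?Q" by simp
    moreover have "z = (\<lambda>(d, e). (h * d, h * e)) (d', e')" unfolding z *(1) *(2) by simp
    ultimately show "z \<in> (\<lambda>(d, e). (h * d, h * e)) ` ?Q" by (rule rev_image_eqI)
  qed
  hence "card ?P \<le> card ?Q" using finQ by (meson card_image_le card_mono finite_imageI le_trans)
  hence "real (card ?P) \<le> real Y * (1 + ln (real Y))" using card_pairs_prod_le[of Y] by linarith
  also have "\<dots> \<le> real A / (real h)\<^sup>2 * (1 + ln (real A))"
  proof (cases "Y = 0")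
    case False
    have "real Y \<le> real A / real (h\<^sup>2)" unfolding Y_def by (rule of_nat_div_le_of_nat)
    moreover have "Y \<le> A" unfolding Y_def by simp
    hence "ln (real Y) \<le> ln (real A)" using False by simp
    ultimately show ?thesis using False by (intro mult_mono) auto
  qed (use assms in simp)
  finally show ?thesis .
qed

text \<open>Group the factorisations by \<open>h = gcd d e\<close>. Each pair has weight
  \<open>h\<close> and there are about \<open>A / h\<^sup>2\<close> of them up to a logarithm, which
  leaves a sum of \<open>1 / h\<close> over certain divisors of \<open>4 * m\<close>.\<close>

lemma sum_gcd_factorisations_le:
  assumes "A > 0" "m > 0"
  shows "real (\<Sum>a=1..A. \<Sum>d | d dvd a \<and> (gcd d (a div d))\<^sup>2 dvd 4 * m. gcd d (a div d)) \<le>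
     real A * (1 + ln (real A)) * inv_divisor_sum (4 * m)"
proof -
  define E where "E a = {d. d dvd a \<and> (gcd d (a div d))\<^sup>2 dvd 4 * m}" for a
  define H where "H = {h. h\<^sup>2 dvd 4 * m}"
  define P where "P h = {(d, e). d > 0 \<and> e > 0 \<and> d * e \<le> A \<and> gcd d e = h}" for h :: nat
  have Hsub: "H \<subseteq> {h. h dvd 4 * m}" unfolding H_def by (auto intro: dvd_trans[of _ "_\<^sup>2"])
  have finH: "finite H" by (rule finite_subset[OF Hsub]) (use assms in simp)
  have finE: "finite (E a)" if "a \<in> {1..A}" for a using that by (simp add: E_def)
  have finP: "finite (P h)" for h
    by (rule finite_subset[OF _ finite_pairs_prod_le[of A]]) (auto simp: P_def)
  have "(\<Sum>a=1..A. \<Sum>d\<in>E a. gcd d (a div d)) = (\<Sum>(a, d)\<in>Sigma {1..A} E. gcd d (a div d))"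
    using finE by (subst sum.Sigma) auto
  also have "\<dots> \<le> (\<Sum>(d, e)\<in>(\<Union>h\<in>H. P h). gcd d e)"
  proof -
    let ?f = "\<lambda>(a, d). (d, a div d)"
    have inj: "inj_on ?f (Sigma {1..A} E)"
    proof (rule inj_onI)
      fix z z' assume z: "z \<in> Sigma {1..A} E" "z' \<in> Sigma {1..A} E" "?f z = ?f z'"
      obtain a d a' d' where zz: "z = (a, d)" "z' = (a', d')" by (metis prod.exhaust)
      have "d dvd a" "d dvd a'" "d = d'" "a div d = a' div d" using z by (auto simp: zz E_def)
      thus "z = z'" by (metis dvd_div_mult_self zz)
    qed
    have "(\<Sum>(a, d)\<in>Sigma {1..A} E. gcd d (a div d)) = (\<Sum>(d, e)\<in>?f ` Sigma {1..A} E. gcd d e)"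
      by (subst sum.reindex[OF inj]) (auto intro!: sum.cong)
    also have "\<dots> \<le> (\<Sum>(d, e)\<in>(\<Union>h\<in>H. P h). gcd d e)"
    proof (rule sum_mono2)
      show "finite (\<Union>h\<in>H. P h)" using finH finP by blast
      show "?f ` Sigma {1..A} E \<subseteq> (\<Union>h\<in>H. P h)"
      proof clarsimp
        fix a d assume a: "Suc 0 \<le> a" "a \<le> A" "d \<in> E a"
        have "d dvd a" using a by (simp add: E_def)
        moreover have "d > 0" using a \<open>d dvd a\<close> by (auto intro: Nat.gr0I)
        ultimately have "(d, a div d) \<in> P (gcd d (a div d))"
          using a by (auto simp: P_def div_greater_zero_iff dvd_imp_le)
        moreover have "gcd d (a div d) \<in> H" using a by (simp add: E_def H_def)
        ultimately show "\<exists>h\<in>H. (d, a div d) \<in> P h" by blast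
      qed
    qed auto
    finally show ?thesis .
  qed
  also have "\<dots> = (\<Sum>h\<in>H. \<Sum>(d, e)\<in>P h. gcd d e)"
    using finH finP by (intro sum.UNION_disjoint) (auto simp: P_def)
  also have "\<dots> = (\<Sum>h\<in>H. card (P h) * h)"
  proof (rule sum.cong[OF refl])
    fix h
    have "(\<Sum>(d, e)\<in>P h. gcd d e) = (\<Sum>z\<in>P h. h)" by (intro sum.cong) (auto simp: P_def)
    thus "(\<Sum>(d, e)\<in>P h. gcd d e) = card (P h) * h" by simp
  qed
  finally have "real (\<Sum>a=1..A. \<Sum>d\<in>E a. gcd d (a div d)) \<le> real (\<Sum>h\<in>H. card (P h) * h)"
    by (simp only: of_nat_le_iff)
  also have "\<dots> = (\<Sum>h\<in>H. real h * real (card (P h)))" by (simp add: mult.commute)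
  also have "\<dots> \<le> (\<Sum>h\<in>H. real A * (1 + ln (real A)) * (1 / real h))"
  proof (rule sum_mono)
    fix h assume "h \<in> H"
    hence h: "h > 0" using assms by (auto simp: H_def intro: Nat.gr0I)
    have "real h * real (card (P h)) \<le> real h * (real A / (real h)\<^sup>2 * (1 + ln (real A)))"
      unfolding P_def by (intro mult_left_mono card_pairs_gcd_le h assms) auto
    also have "\<dots> = real A * (1 + ln (real A)) * (1 / real h)"
      using h by (simp add: power2_eq_square field_simps)
    finally show "real h * real (card (P h)) \<le> real A * (1 + ln (real A)) * (1 / real h)" .
  qed
  also have "\<dots> = real A * (1 + ln (real A)) * (\<Sum>h\<in>H. 1 / real h)" by (simp add: sum_distrib_left)
  also have "\<dots> \<le> real A * (1 + ln (real A)) * inv_divisor_sum (4 * m)"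
    unfolding inv_divisor_sum_def using assms
    by (intro mult_left_mono sum_mono2 Hsub mult_nonneg_nonneg) auto
  finally show ?thesis by (simp add: E_def)
qed

lemma weighted_class_number_le:
  assumes "m > 0"
  shows "weighted_class_number (- int m) \<le>
    3 * sqrt (real m) * (1 + ln (real m)) * inv_divisor_sum (4 * m)"
proof -
  define A where "A = nat \<lfloor>sqrt (real m)\<rfloor>"
  have A_le: "real A \<le> sqrt (real m)" by (simp add: A_def)
  have A1: "A > 0" using assms by (simp add: A_def le_floor_iff)
  have S0: "inv_divisor_sum (4 * m) \<ge> 0" by (rule inv_divisor_sum_nonneg)
  define B where "B a = {b::int. \<bar>b\<bar> \<le> int a \<and> int a dvd b\<^sup>2 + int m}" for a
  have finB: "finite (B a)" for a
    by (rule finite_subset[of _ "{- int a..int a}"]) (auto simp: B_def)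
  \<comment> \<open>The discriminant recovers \<open>c\<close> from \<open>a\<close> and
    \<open>b\<close>, so it suffices to count pairs \<open>(a, b)\<close> with \<open>b\<close> a
    root modulo \<open>a\<close>.\<close>
  let ?f = "\<lambda>(a, b, c). (nat a, b :: int)"
  have inj: "inj_on ?f (reduced_forms (int m))"
  proof (rule inj_onI)
    fix z z' assume z: "z \<in> reduced_forms (int m)" "z' \<in> reduced_forms (int m)" "?f z = ?f z'"
    obtain a b c a' b' c' where zz: "z = (a, b, c)" "z' = (a', b', c')" by (metis prod.exhaust)
    have ab: "a = a'" "b = b'" using z by (auto simp: zz reduced_forms_def)
    hence "a > 0" and eq: "4 * a * c - b\<^sup>2 = int m" "4 * a * c' - b\<^sup>2 = int m"
      using z by (auto simp: zz reduced_forms_def)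
    have "4 * a * c = 4 * a * c'" using eq by linarith
    thus "z = z'" using \<open>a > 0\<close> ab zz by simp
  qed
  have sub: "?f ` reduced_forms (int m) \<subseteq> Sigma {1..A} B"
  proof (rule image_subsetI)
    fix z assume z: "z \<in> reduced_forms (int m)"
    obtain a b c where zz: "z = (a, b, c)" by (metis prod.exhaust)
    have R: "(a, b, c) \<in> reduced_forms (int m)" using z zz by simp
    have h: "0 < a" "\<bar>b\<bar> \<le> a" "a \<le> c" "4 * a * c - b\<^sup>2 = int m"
      using R by (auto simp: reduced_forms_def)
    have "a\<^sup>2 \<le> int m" using reduced_form_bound[OF R] zero_le_power2[of a] by linarith
    hence "(real_of_int a)\<^sup>2 \<le> real m" by (metis of_int_le_iff of_int_of_nat_eq of_int_power)
    hence "real_of_int a \<le> sqrt (real m)" by (rule real_le_rsqrt)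
    hence "a \<le> \<lfloor>sqrt (real m)\<rfloor>" by (simp add: le_floor_iff)
    hence "nat a \<in> {1..A}" using h by (auto simp: A_def)
    moreover have "b\<^sup>2 + int m = a * (4 * c)" using h(4) by (simp add: algebra_simps)
    hence "a dvd b\<^sup>2 + int m" by simp
    hence "b \<in> B (nat a)" using h by (simp add: B_def)
    ultimately show "?f z \<in> Sigma {1..A} B" by (simp add: zz)
  qed
  have "card (reduced_forms (int m)) \<le> card (Sigma {1..A} B)"
    using card_inj_on_le[OF inj sub] finB by auto
  also have "\<dots> = (\<Sum>a=1..A. card (B a))" using finB by simp
  also have "\<dots> \<le> (\<Sum>a=1..A. 3 * (\<Sum>d | d dvd a \<and> (gcd d (a div d))\<^sup>2 dvd 4 * m. gcd d (a div d)))"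
    unfolding B_def by (intro sum_mono card_roots_le) auto
  also have "\<dots> = 3 * (\<Sum>a=1..A. \<Sum>d | d dvd a \<and> (gcd d (a div d))\<^sup>2 dvd 4 * m. gcd d (a div d))"
    by (simp add: sum_distrib_left)
  finally have "real (card (reduced_forms (int m))) \<le>
     3 * real (\<Sum>a=1..A. \<Sum>d | d dvd a \<and> (gcd d (a div d))\<^sup>2 dvd 4 * m. gcd d (a div d))"
    by (metis (no_types, lifting) of_nat_le_iff of_nat_mult of_nat_numeral)
  also have "\<dots> \<le> 3 * (real A * (1 + ln (real A)) * inv_divisor_sum (4 * m))"
    using sum_gcd_factorisations_le[OF A1 assms] by simp
  also have "\<dots> \<le> 3 * (sqrt (real m) * (1 + ln (real m)) * inv_divisor_sum (4 * m))"
  proof -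
    have "sqrt (real m) \<le> real m" using assms
      by (intro real_le_lsqrt) (auto simp: power2_eq_square)
    hence "ln (real A) \<le> ln (real m)" using A_le A1 assms by simp
    moreover have "ln (real m) \<ge> 0" using assms by simp
    ultimately show ?thesis using A_le S0 A1 by (intro mult_left_mono mult_right_mono mult_mono) auto
  qed
  finally show ?thesis using weighted_class_number_le_card_reduced[of "int m"] by (simp add: mult.assoc)
qed

section \<open>The coefficients\<close>

lemma nu_ge_1:
  assumes "d > 0"
  shows "nu d \<ge> 1"
proof -
  have "1 * 1 \<le> nu d" unfolding nu_def
    using assms by (intro mult_mono prod_ge_1) auto
  thus ?thesis by simp
qed

lemma num_sols_le: "num_sols t n K \<le> K"
proof -
  have "num_sols t n K \<le> card {0..<int K}"
    unfolding num_sols_def by (intro card_mono) auto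
  thus ?thesis by simp
qed

text \<open>What matters is a bound free of \<open>t\<close>, \<open>f\<close> and \<open>n\<close>:
  the gcd is at most \<open>d\<close>, a modulus \<open>K\<close> admits at most \<open>K\<close>
  roots, and the denominator is at least 1.\<close>

lemma mu_bounds:
  assumes "d > 0"
  shows "0 \<le> mu t f n d" "mu t f n d \<le> nu d * (real d)\<^sup>2"
proof -
  define g where "g = gcd d f"
  have g: "g > 0" "g dvd d" using assms by (auto simp: g_def)
  have "d div g > 0" using g assms by (simp add: div_greater_zero_iff dvd_imp_le)
  hence nu: "nu (d div g) \<ge> 1" "nu d \<ge> 1" using assms by (auto intro: nu_ge_1)
  show "0 \<le> mu t f n d" unfolding mu_def using nu by (simp add: g_def)
  have "num_sols t n (d * g) \<le> d * g" by (rule num_sols_le)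
  also have "\<dots> \<le> d * d" using g assms by (simp add: dvd_imp_le)
  finally have "real (num_sols t n (d * g)) \<le> real (d * d)" by (simp only: of_nat_le_iff)
  hence ns: "real (num_sols t n (d * g)) \<le> (real d)\<^sup>2" by (simp add: power2_eq_square)
  have "nu d / nu (d div g) \<le> nu d" using nu by (simp add: divide_le_eq mult_le_cancel_left1)
  thus "mu t f n d \<le> nu d * (real d)\<^sup>2" unfolding mu_def g_def[symmetric]
    using ns nu by (intro mult_mono) auto
qed

lemma mu_tilde_bounded:
  assumes "N > 0"
  obtains M where "M > 0" "\<And>t f n. \<bar>mu_tilde t f n N\<bar> \<le> M"
proof
  let ?M = "1 + (\<Sum>d | d dvd N. real (divisor_count (N div d)) * (nu d * (real d)\<^sup>2))"
  have nn: "0 \<le> real (divisor_count (N div d)) * (nu d * (real d)\<^sup>2)" if "d dvd N" for d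
  proof -
    have "d > 0" using that assms by (auto intro: Nat.gr0I)
    thus ?thesis using nu_ge_1[of d] by (intro mult_nonneg_nonneg) auto
  qed
  have "0 \<le> (\<Sum>d | d dvd N. real (divisor_count (N div d)) * (nu d * (real d)\<^sup>2))"
    by (intro sum_nonneg) (use nn in auto)
  thus "?M > 0" by linarith
  fix t f n
  have "\<bar>mu_tilde t f n N\<bar> \<le> (\<Sum>d | d dvd N. \<bar>real (divisor_count (N div d)) * of_int (moebius (N div d)) * mu t f n d\<bar>)"
    unfolding mu_tilde_def by (rule sum_abs)
  also have "\<dots> \<le> (\<Sum>d | d dvd N. real (divisor_count (N div d)) * (nu d * (real d)\<^sup>2))"
  proof (rule sum_mono)
    fix d assume "d \<in> {d. d dvd N}"
    hence d: "d > 0" using assms by (auto intro: Nat.gr0I)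
    have "\<bar>moebius (N div d)\<bar> \<le> 1" by (simp add: moebius_def power_abs)
    hence "\<bar>real_of_int (moebius (N div d))\<bar> \<le> 1" by linarith
    hence "\<bar>of_int (moebius (N div d)) * mu t f n d\<bar> \<le> 1 * (nu d * (real d)\<^sup>2)"
      unfolding abs_mult using mu_bounds[OF d, of t f n] by (intro mult_mono) auto
    hence "real (divisor_count (N div d)) * \<bar>of_int (moebius (N div d)) * mu t f n d\<bar> \<le>
        real (divisor_count (N div d)) * (nu d * (real d)\<^sup>2)" by (intro mult_left_mono) auto
    thus "\<bar>real (divisor_count (N div d)) * of_int (moebius (N div d)) * mu t f n d\<bar> \<le>
       real (divisor_count (N div d)) * (nu d * (real d)\<^sup>2)" by (simp add: abs_mult mult.assoc)
  qed
  finally show "\<bar>mu_tilde t f n N\<bar> \<le> ?M" by linarith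
qed

section \<open>The sum over the conductors\<close>

lemma in_conductorsD:
  assumes "f \<in> conductors (- int m)"
  shows "f > 0" "f\<^sup>2 dvd m" "- int m div (int f)\<^sup>2 = - int (m div f\<^sup>2)"
proof -
  show "f > 0" using assms by (simp add: conductors_def)
  have "(int f)\<^sup>2 dvd int m" using assms by (simp add: conductors_def)
  hence "int (f\<^sup>2) dvd int m" by simp
  thus d: "f\<^sup>2 dvd m" by (simp only: int_dvd_int_iff)
  show "- int m div (int f)\<^sup>2 = - int (m div f\<^sup>2)"
    using \<open>(int f)\<^sup>2 dvd int m\<close> by (simp add: dvd_neg_div zdiv_int)
qed

lemma conductors_subset_divisors: "conductors (- int m) \<subseteq> {f. f dvd m}"
proof
  fix f assume "f \<in> conductors (- int m)"
  hence "f * f dvd m" using in_conductorsD(2) by (simp add: power2_eq_square)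
  thus "f \<in> {f. f dvd m}" by (auto dest: dvd_mult_left)
qed

lemma finite_conductors: "m > 0 \<Longrightarrow> finite (conductors (- int m))"
  using conductors_subset_divisors by (rule finite_subset) simp

text \<open>Passing from \<open>m\<close> to \<open>m / f\<^sup>2\<close> divides the square root by
  \<open>f\<close>, and the remaining factors are monotone. The sum of \<open>1 / f\<close> over the
  conductors is the second factor \<open>inv_divisor_sum (4 * m)\<close>.\<close>

lemma sum_conductors_class_number_le:
  assumes "m > 0"
  shows "(\<Sum>f \<in> conductors (- int m). weighted_class_number (- int m div (int f)\<^sup>2)) \<le>
    3 * sqrt (real m) * (1 + ln (real m)) * (inv_divisor_sum (4 * m))\<^sup>2"
proof -
  define K where "K = 3 * sqrt (real m) * (1 + ln (real m)) * inv_divisor_sum (4 * m)"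
  have K0: "K \<ge> 0" unfolding K_def using assms inv_divisor_sum_nonneg by (intro mult_nonneg_nonneg) auto
  have "(\<Sum>f \<in> conductors (- int m). weighted_class_number (- int m div (int f)\<^sup>2)) \<le>
      (\<Sum>f \<in> conductors (- int m). K * (1 / real f))"
  proof (rule sum_mono)
    fix f assume "f \<in> conductors (- int m)"
    note f = in_conductorsD[OF this]
    define m' where "m' = m div f\<^sup>2"
    have m: "m = f\<^sup>2 * m'" using f by (simp add: m'_def)
    have m': "m' > 0" using assms m by (auto intro: Nat.gr0I)
    have m'_le: "m' \<le> m" by (simp add: m'_def)
    have sq: "sqrt (real m') = sqrt (real m) / real f" using f(1) by (simp add: m real_sqrt_mult)
    have "weighted_class_number (- int m') \<le> 3 * sqrt (real m') * (1 + ln (real m')) * inv_divisor_sum (4 * m')"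
      by (rule weighted_class_number_le[OF m'])
    also have "\<dots> \<le> 3 * sqrt (real m') * (1 + ln (real m)) * inv_divisor_sum (4 * m)"
    proof -
      have "inv_divisor_sum (4 * m') \<le> inv_divisor_sum (4 * m)"
        using assms by (intro inv_divisor_sum_mono) (auto simp: m)
      moreover have "0 \<le> ln (real m')" "ln (real m') \<le> ln (real m)" using m' m'_le assms by simp_all
      ultimately show ?thesis using inv_divisor_sum_nonneg
        by (intro mult_mono mult_left_mono mult_nonneg_nonneg) auto
    qed
    also have "\<dots> = K * (1 / real f)" by (simp add: K_def sq)
    finally show "weighted_class_number (- int m div (int f)\<^sup>2) \<le> K * (1 / real f)"
      by (simp only: f(3) m'_def)
  qed
  also have "\<dots> = K * (\<Sum>f \<in> conductors (- int m). 1 / real f)" by (simp add: sum_distrib_left)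
  also have "(\<Sum>f \<in> conductors (- int m). 1 / real f) \<le> inv_divisor_sum (4 * m)"
    unfolding inv_divisor_sum_def using conductors_subset_divisors[of m] assms
    by (intro sum_mono2) auto
  finally have "(\<Sum>f \<in> conductors (- int m). weighted_class_number (- int m div (int f)\<^sup>2)) \<le>
      K * inv_divisor_sum (4 * m)" using K0 by (simp only: mult_left_mono)
  thus ?thesis by (simp add: K_def power2_eq_square[of "inv_divisor_sum _"] mult.assoc)
qed

lemma cmod_D_coeff_power2:
  assumes "int m = 4 * int n - t\<^sup>2" "m > 0"
  shows "(cmod (D_coeff N t n))\<^sup>2 =
    (\<Sum>f \<in> conductors (- int m). weighted_class_number (- int m div (int f)\<^sup>2) * mu_tilde t f n N)\<^sup>2
      / (4 * real m)"
proof -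
  have 1: "t\<^sup>2 - 4 * int n = - int m" using assms by simp
  have 2: "real_of_int (4 * int n - t\<^sup>2) = real m" by (simp flip: assms(1))
  show ?thesis unfolding D_coeff_def 1 2
    by (simp add: norm_mult norm_divide power_mult_distrib power_divide flip: of_real_sum of_real_mult)
qed

text \<open>The factor \<open>m\<close> from squaring the class number bound cancels against the
  normalisation \<open>1 / (4 * m)\<close>, so only logarithmic quantities are left.\<close>

lemma cmod_D_coeff_power2_le:
  assumes "int m = 4 * int n - t\<^sup>2" "m > 0" "\<And>f. \<bar>mu_tilde t f n N\<bar> \<le> M"
  shows "(cmod (D_coeff N t n))\<^sup>2 \<le> 9 / 4 * M\<^sup>2 * (1 + ln (real m))\<^sup>2 * inv_divisor_sum (4 * m) ^ 4"
proof -
  define S where "S = (\<Sum>f \<in> conductors (- int m). weighted_class_number (- int m div (int f)\<^sup>2) * mu_tilde t f n N)"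
  have M0: "M \<ge> 0" using assms(3)[of 0] by linarith
  have "\<bar>S\<bar> \<le> (\<Sum>f \<in> conductors (- int m). \<bar>weighted_class_number (- int m div (int f)\<^sup>2) * mu_tilde t f n N\<bar>)"
    unfolding S_def by (rule sum_abs)
  also have "\<dots> \<le> (\<Sum>f \<in> conductors (- int m). weighted_class_number (- int m div (int f)\<^sup>2) * M)"
    unfolding abs_mult using assms(3) weighted_class_number_nonneg
    by (intro sum_mono mult_mono) auto
  also have "\<dots> = (\<Sum>f \<in> conductors (- int m). weighted_class_number (- int m div (int f)\<^sup>2)) * M"
    by (simp add: sum_distrib_right)
  also have "\<dots> \<le> 3 * sqrt (real m) * (1 + ln (real m)) * (inv_divisor_sum (4 * m))\<^sup>2 * M"
    by (intro mult_right_mono sum_conductors_class_number_le assms M0)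
  finally have "\<bar>S\<bar>\<^sup>2 \<le> (3 * sqrt (real m) * (1 + ln (real m)) * (inv_divisor_sum (4 * m))\<^sup>2 * M)\<^sup>2"
    by (intro power_mono) auto
  also have "\<dots> = 9 * real m * (1 + ln (real m))\<^sup>2 * inv_divisor_sum (4 * m) ^ 4 * M\<^sup>2"
    by (simp add: power_mult_distrib flip: power_mult)
  finally have "S\<^sup>2 / (4 * real m) \<le>
      9 * real m * (1 + ln (real m))\<^sup>2 * inv_divisor_sum (4 * m) ^ 4 * M\<^sup>2 / (4 * real m)"
    by (intro divide_right_mono) auto
  also have "\<dots> = 9 / 4 * M\<^sup>2 * (1 + ln (real m))\<^sup>2 * inv_divisor_sum (4 * m) ^ 4"
    using assms(2) by simp
  finally show ?thesis unfolding cmod_D_coeff_power2[OF assms(1,2)] S_def .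
qed

section \<open>The range of traces and the upper bound for the second moment\<close>

lemma traces_subset:
  "{t. t\<^sup>2 < 4 * int n} \<subseteq> {- \<lfloor>2 * sqrt (real n)\<rfloor>..\<lfloor>2 * sqrt (real n)\<rfloor>}"
proof
  fix t assume "t \<in> {t. t\<^sup>2 < 4 * int n}"
  hence "t\<^sup>2 \<le> 4 * int n" by simp
  hence "real_of_int (t\<^sup>2) \<le> real_of_int (4 * int n)" by (simp only: of_int_le_iff)
  hence "(real_of_int \<bar>t\<bar>)\<^sup>2 \<le> 4 * real n" by simp
  hence "real_of_int \<bar>t\<bar> \<le> sqrt (4 * real n)" by (rule real_le_rsqrt)
  hence "real_of_int \<bar>t\<bar> \<le> 2 * sqrt (real n)" by (simp add: real_sqrt_mult)
  hence "\<bar>t\<bar> \<le> \<lfloor>2 * sqrt (real n)\<rfloor>" by (simp add: le_floor_iff)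
  thus "t \<in> {- \<lfloor>2 * sqrt (real n)\<rfloor>..\<lfloor>2 * sqrt (real n)\<rfloor>}" by auto
qed

lemma finite_traces: "finite {t. t\<^sup>2 < 4 * int n}"
  using traces_subset by (rule finite_subset) simp

lemma card_traces_le:
  assumes "n > 0"
  shows "real (card {t. t\<^sup>2 < 4 * int n}) \<le> 5 * sqrt (real n)"
proof -
  define k where "k = \<lfloor>2 * sqrt (real n)\<rfloor>"
  have k: "0 \<le> k" "real_of_int k \<le> 2 * sqrt (real n)" by (simp_all add: k_def)
  have "card {t. t\<^sup>2 < 4 * int n} \<le> card {- k..k}"
    unfolding k_def by (intro card_mono traces_subset) auto
  hence "real (card {t. t\<^sup>2 < 4 * int n}) \<le> 2 * real_of_int k + 1" using k(1) by simp
  moreover have "sqrt (real n) \<ge> 1" using assms by simp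
  ultimately show ?thesis using k(2) by linarith
qed

lemma sum_D_coeff_le:
  assumes "N > 0"
  obtains C where "C > 0"
    "\<And>n. n \<ge> 3 \<Longrightarrow> (\<Sum>t | t\<^sup>2 < 4 * int n. (cmod (D_coeff N t n))\<^sup>2)
       \<le> C * (sqrt (real n) * (ln (real n))\<^sup>2 * (ln (ln (real n))) ^ 4)"
proof -
  obtain M where M: "M > 0" "\<And>t f n. \<bar>mu_tilde t f n N\<bar> \<le> M" using mu_tilde_bounded[OF assms] by blast
  have ln3: "ln (3::real) > 1"
    using ln_272_gt_1 ln_less_cancel_iff[of "272/100" "3::real"] by linarith
  \<comment> \<open>A positive lower bound for \<open>ln (ln n)\<close> on \<open>n \<ge> 3\<close>,
    by which additive constants turn into multiples of \<open>ln (ln n)\<close>.\<close>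
  define \<delta> where "\<delta> = ln (ln (3::real))"
  have \<delta>: "\<delta> > 0" using ln3 by (simp add: \<delta>_def)
  define C0 where "C0 = 74 / \<delta> + 16"
  have C0: "C0 > 0" using \<delta> by (simp add: C0_def add_pos_pos)
  \<comment> \<open>The 5 comes from the number of traces, \<open>9 / 4 * M\<^sup>2\<close> from the
    bound for one coefficient, 16 from \<open>(4 * l)\<^sup>2\<close>, and \<open>C0 ^ 4\<close>
    from the divisor sums.\<close>
  define C where "C = 5 * (9 / 4 * M\<^sup>2 * 16 * C0 ^ 4)"
  show thesis
  proof
    show "C > 0" using M(1) C0 by (simp add: C_def)
    fix n :: nat assume n: "n \<ge> 3"
    define l where "l = ln (real n)"
    have "ln 3 \<le> l" unfolding l_def using n by simp
    hence l1: "l > 1" using ln3 by linarith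
    have lnl: "ln l \<ge> \<delta>" unfolding \<delta>_def using \<open>ln 3 \<le> l\<close> ln3 l1 by simp
    have ln16: "ln (16::real) \<le> 3 * l"
    proof -
      have "ln (16::real) \<le> ln (3 ^ 3)" by simp
      also have "\<dots> = 3 * ln 3" by (subst ln_realpow) auto
      finally show ?thesis using \<open>ln 3 \<le> l\<close> by linarith
    qed
    have "(cmod (D_coeff N t n))\<^sup>2 \<le> 9 / 4 * M\<^sup>2 * (4 * l)\<^sup>2 * (C0 * ln l) ^ 4" if t: "t\<^sup>2 < 4 * int n" for t
    proof -
      define m where "m = nat (4 * int n - t\<^sup>2)"
      have m: "int m = 4 * int n - t\<^sup>2" "m > 0" using t by (auto simp: m_def)
      have m_le: "m \<le> 4 * n" using m(1) zero_le_power2[of t] by linarith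
      have "ln (real (4 * m)) \<le> ln (real (16 * n))"
        using m_le m(2) n by (subst ln_le_cancel_iff) auto
      also have "\<dots> = ln 16 + l" using n by (simp add: l_def ln_mult)
      also have "\<dots> \<le> 4 * l" using ln16 by linarith
      finally have ln4m: "ln (real (4 * m)) \<le> 4 * l" .
      have "ln (real m) \<le> ln (real (4 * n))" using m_le m(2) n by (subst ln_le_cancel_iff) auto
      also have "\<dots> = ln 4 + l" using n by (simp add: l_def ln_mult)
      also have "ln (4::real) \<le> 2 * l"
      proof -
        have "ln (4::real) \<le> ln (3 ^ 2)" by simp
        also have "\<dots> = 2 * ln 3" by (subst ln_realpow) auto
        finally show ?thesis using \<open>ln 3 \<le> l\<close> by linarith
      qed
      finally have lnm: "1 + ln (real m) \<le> 4 * l" using l1 by linarith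
      \<comment> \<open>An integer that is at least \<open>4 * l\<close>, hence at least
        \<open>ln (4 * m)\<close>, and at most \<open>5 * l\<close> because
        \<open>l > 1\<close>.\<close>
      define y where "y = nat \<lceil>4 * l\<rceil>"
      have y: "4 * l \<le> real y" "real y \<le> 5 * l" using l1 unfolding y_def by linarith+
      have y0: "y > 0" using y l1 by (auto intro: Nat.gr0I)
      have "ln (real y) \<le> ln (5 * l)" using y y0 l1 by simp
      also have "\<dots> = ln 5 + ln l" using l1 by (simp add: ln_mult)
      also have "ln (5::real) \<le> 4" using ln_le_minus_one[of "5::real"] by simp
      finally have lny: "ln (real y) \<le> 4 + ln l" by simp
      have "inv_divisor_sum (4 * m) \<le> 10 + 16 * ln (real y)"
        using m(2) y0 ln4m y by (intro inv_divisor_sum_le) auto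
      also have "\<dots> \<le> 74 + 16 * ln l" using lny by simp
      also have "\<dots> \<le> C0 * ln l"
      proof -
        have "74 = 74 / \<delta> * \<delta>" using \<delta> by simp
        also have "\<dots> \<le> 74 / \<delta> * ln l" using lnl \<delta> by (intro mult_left_mono) auto
        finally show ?thesis by (simp add: C0_def algebra_simps)
      qed
      finally have S: "inv_divisor_sum (4 * m) \<le> C0 * ln l" .
      have "(cmod (D_coeff N t n))\<^sup>2 \<le> 9 / 4 * M\<^sup>2 * (1 + ln (real m))\<^sup>2 * inv_divisor_sum (4 * m) ^ 4"
        by (rule cmod_D_coeff_power2_le[OF m M(2)])
      also have "\<dots> \<le> 9 / 4 * M\<^sup>2 * (4 * l)\<^sup>2 * (C0 * ln l) ^ 4"
        using lnm S m(2) inv_divisor_sum_nonneg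
        by (intro mult_mono mult_left_mono power_mono) auto
      finally show ?thesis .
    qed
    hence "(\<Sum>t | t\<^sup>2 < 4 * int n. (cmod (D_coeff N t n))\<^sup>2) \<le>
        (\<Sum>t | t\<^sup>2 < 4 * int n. 9 / 4 * M\<^sup>2 * (4 * l)\<^sup>2 * (C0 * ln l) ^ 4)"
      by (intro sum_mono) auto
    also have "\<dots> = real (card {t. t\<^sup>2 < 4 * int n}) * (9 / 4 * M\<^sup>2 * (4 * l)\<^sup>2 * (C0 * ln l) ^ 4)" by simp
    also have "\<dots> \<le> 5 * sqrt (real n) * (9 / 4 * M\<^sup>2 * (4 * l)\<^sup>2 * (C0 * ln l) ^ 4)"
      using n by (intro mult_right_mono card_traces_le) auto
    also have "\<dots> = C * (sqrt (real n) * l\<^sup>2 * (ln l) ^ 4)"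
      by (simp add: C_def power_mult_distrib)
    finally show "(\<Sum>t | t\<^sup>2 < 4 * int n. (cmod (D_coeff N t n))\<^sup>2)
       \<le> C * (sqrt (real n) * (ln (real n))\<^sup>2 * (ln (ln (real n))) ^ 4)" by (simp add: l_def)
  qed
qed

section \<open>Traces with an irreducible characteristic polynomial\<close>

text \<open>Pigeonhole: a root is a unit modulo \<open>p\<close> because \<open>p\<close> does not
  divide \<open>n\<close>, and a unit root determines \<open>t\<close>. So \<open>p\<close> traces
  would need distinct roots among \<open>p - 1\<close> units.\<close>

lemma exists_irreducible_trace_prime:
  fixes n p :: nat
  assumes "prime p" "\<not> p dvd n"
  shows "\<exists>t::int. \<forall>x. \<not> int p dvd x\<^sup>2 - t * x + int n"
proof (rule ccontr)
  assume "\<not> ?thesis"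
  hence ex: "\<forall>t. \<exists>x. int p dvd x\<^sup>2 - t * x + int n" by blast
  have p: "int p > 0" using assms by (simp add: prime_gt_0_nat)
  have pp: "prime (int p)" using assms by simp
  have "\<exists>x\<in>{1..<int p}. int p dvd x\<^sup>2 - t * x + int n" for t
  proof -
    obtain x where x: "int p dvd x\<^sup>2 - t * x + int n" using ex by blast
    define y where "y = x mod int p"
    have "[y\<^sup>2 - t * y + int n = x\<^sup>2 - t * x + int n] (mod int p)"
      unfolding y_def by (intro cong_add cong_diff cong_mult cong_pow cong_refl) (simp_all add: cong_def)
    hence y: "int p dvd y\<^sup>2 - t * y + int n" using x by (simp add: cong_dvd_iff)
    have "y \<noteq> 0" using y assms(2) by auto
    moreover have "0 \<le> y" "y < int p" using p by (simp_all add: y_def)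
    ultimately show ?thesis using y by (intro bexI[of _ y]) auto
  qed
  then obtain r where r: "\<And>t. r t \<in> {1..<int p}" "\<And>t. int p dvd (r t)\<^sup>2 - t * r t + int n"
    by metis
  have "inj_on r {0..<int p}"
  proof (rule inj_onI)
    fix s t assume st: "s \<in> {0..<int p}" "t \<in> {0..<int p}" "r s = r t"
    \<comment> \<open>Subtracting two equations with a common root leaves
      \<open>(s - t) * r s\<close>.\<close>
    have "int p dvd ((r t)\<^sup>2 - t * r t + int n) - ((r s)\<^sup>2 - s * r s + int n)"
      by (intro dvd_diff r)
    also have "\<dots> = (s - t) * r s" using st(3) by (simp add: algebra_simps)
    finally have "int p dvd s - t \<or> int p dvd r s" using pp by (simp add: prime_dvd_mult_iff)
    moreover have "\<not> int p dvd r s" using r(1)[of s] by (auto dest: zdvd_imp_le)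
    ultimately have "s mod int p = t mod int p" by (simp add: mod_eq_dvd_iff)
    thus "s = t" using st by simp
  qed
  hence "card {0..<int p} \<le> card {1..<int p}"
    using r(1) by (intro card_inj_on_le[of r]) auto
  thus False using p by simp
qed

text \<open>Having no root modulo \<open>p\<close> depends only on \<open>t\<close> modulo
  \<open>p\<close>, so the Chinese remainder theorem combines the choices, one prime at a
  time.\<close>

lemma exists_irreducible_trace:
  fixes n N :: nat
  assumes "coprime n N" "N > 0"
  shows "\<exists>t::int. \<forall>p x. prime p \<longrightarrow> p dvd N \<longrightarrow> \<not> int p dvd x\<^sup>2 - t * x + int n"
proof -
  have "\<exists>t::int. \<forall>p\<in>P. \<forall>x. \<not> int p dvd x\<^sup>2 - t * x + int n"
    if "finite P" "\<And>p. p \<in> P \<Longrightarrow> prime p \<and> \<not> p dvd n" for P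
    using that
  proof (induction P rule: finite_induct)
    case (insert q P)
    obtain t1 where t1: "\<forall>p\<in>P. \<forall>x. \<not> int p dvd x\<^sup>2 - t1 * x + int n"
      using insert by blast
    obtain t2 where t2: "\<forall>x. \<not> int q dvd x\<^sup>2 - t2 * x + int n"
      using exists_irreducible_trace_prime[of q n] insert.prems by blast
    have "coprime (\<Prod>P) q"
      using insert by (intro prod_coprime_left) (auto intro!: primes_coprime)
    hence "coprime (int (\<Prod>P)) (int q)" by (simp only: coprime_int_iff)
    then obtain t where t: "[t = t1] (mod int (\<Prod>P))" "[t = t2] (mod int q)"
      using binary_chinese_remainder_int by blast
    have tr: "int p dvd x\<^sup>2 - t * x + int n \<longleftrightarrow> int p dvd x\<^sup>2 - t' * x + int n" if "[t = t'] (mod int p)" for p t' x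
      using that by (intro cong_dvd_iff cong_add cong_diff cong_mult cong_refl)
    have "\<not> int p dvd x\<^sup>2 - t * x + int n" if "p \<in> insert q P" for p x
    proof (cases "p = q")
      case True
      thus ?thesis using t2 tr[OF t(2)] by blast
    next
      case False
      hence "p \<in> P" using that by simp
      hence "int p dvd int (\<Prod>P)" using dvd_prodI[OF insert.hyps(1), of p "\<lambda>x. x"] by (simp only: int_dvd_int_iff)
      hence "[t = t1] (mod int p)" using t(1) cong_dvd_modulus by blast
      thus ?thesis using t1 tr \<open>p \<in> P\<close> by blast
    qed
    thus ?case by blast
  qed auto
  moreover have "prime p \<and> \<not> p dvd n" if "p \<in> prime_factors N" for p
    using that assms(1) by (metis coprime_common_divisor in_prime_factors_iff not_prime_unit)
  ultimately obtain t where
    t: "\<forall>p\<in>prime_factors N. \<forall>x. \<not> int p dvd x\<^sup>2 - t * x + int n"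
    by (meson finite_set_mset)
  thus ?thesis using assms(2) by (metis in_prime_factors_iff less_irrefl)
qed

text \<open>For \<open>d \<noteq> 1\<close> a root modulo \<open>d * gcd d f\<close> would also be a
  root modulo a prime factor of \<open>d\<close>; only \<open>d = 1\<close> survives.\<close>

lemma mu_tilde_irreducible:
  assumes "squarefree N" "\<And>p x. prime p \<Longrightarrow> p dvd N \<Longrightarrow> \<not> int p dvd x\<^sup>2 - t * x + int n"
  shows "mu_tilde t f n N = real (divisor_count N) * of_int (moebius N)"
proof -
  have N: "N > 0" using assms(1) by (auto intro: Nat.gr0I)
  have mu0: "mu t f n d = 0" if d: "d dvd N" "d \<noteq> 1" for d
  proof -
    obtain p where p: "prime p" "p dvd d" using d(2) prime_factor_nat by blast
    have "\<not> [x\<^sup>2 - t * x + int n = 0] (mod int (d * gcd d f))" for x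
    proof
      assume "[x\<^sup>2 - t * x + int n = 0] (mod int (d * gcd d f))"
      hence "int (d * gcd d f) dvd x\<^sup>2 - t * x + int n" by (simp only: cong_0_iff)
      moreover have "int p dvd int (d * gcd d f)" using p(2) by (simp only: int_dvd_int_iff dvd_mult2)
      ultimately have "int p dvd x\<^sup>2 - t * x + int n" by (rule dvd_trans[rotated])
      thus False using assms(2) p d(1) dvd_trans by blast
    qed
    hence "num_sols t n (d * gcd d f) = 0" unfolding num_sols_def by simp
    thus ?thesis by (simp add: mu_def)
  qed
  \<comment> \<open>Modulo 1 the residue 0 is a root, so the surviving term is 1 and not 0.\<close>
  have "{x \<in> {0..<int 1}. [x\<^sup>2 - t * x + int n = 0] (mod int 1)} = {0}" by auto
  hence "num_sols t n 1 = 1" unfolding num_sols_def by simp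
  hence mu1: "mu t f n 1 = 1" by (simp add: mu_def nu_def)
  have "mu_tilde t f n N = (\<Sum>d\<in>{1}. real (divisor_count (N div d)) * of_int (moebius (N div d)) * mu t f n d)"
    unfolding mu_tilde_def using N mu0 by (intro sum.mono_neutral_right) auto
  thus ?thesis using mu1 by simp
qed

text \<open>Here \<open>mu_tilde\<close> does not vary with \<open>f\<close> and has absolute value
  at least 1. It factors out, and since class numbers are nonnegative, the conductor 1 alone bounds
  the sum from below. The 16 comes from \<open>4 * m \<le> 16 * n\<close>.\<close>

lemma class_number_le_cmod_D_coeff:
  assumes "squarefree N" "\<And>p x. prime p \<Longrightarrow> p dvd N \<Longrightarrow> \<not> int p dvd x\<^sup>2 - t * x + int n"
    and "t\<^sup>2 < 4 * int n"
  shows "(weighted_class_number (t\<^sup>2 - 4 * int n))\<^sup>2 / (16 * real n) \<le> (cmod (D_coeff N t n))\<^sup>2"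
proof -
  have N: "N > 0" using assms(1) by (auto intro: Nat.gr0I)
  define m where "m = nat (4 * int n - t\<^sup>2)"
  have m: "int m = 4 * int n - t\<^sup>2" "m > 0" using assms(3) by (auto simp: m_def)
  have D: "t\<^sup>2 - 4 * int n = - int m" using m by simp
  define h where "h f = weighted_class_number (- int m div (int f)\<^sup>2)" for f
  define F where "F = conductors (- int m)"
  have h0: "h f \<ge> 0" for f unfolding h_def by (rule weighted_class_number_nonneg)
  \<comment> \<open>Squares are 0 or 1 modulo 4, which makes 1 a conductor.\<close>
  have "(t\<^sup>2 - 4 * int n) mod 4 = t\<^sup>2 mod 4" by (metis mod_mult_self2 diff_add_cancel)
  also have "\<dots> \<in> {0, 1}"
  proof (cases "even t")
    case True
    then obtain s where "t = 2 * s" by blast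
    thus ?thesis by (simp add: power_mult_distrib)
  next
    case False
    then obtain s where "t = 2 * s + 1" by (blast elim: oddE)
    hence "t\<^sup>2 = 1 + 4 * (s\<^sup>2 + s)" by (simp add: power2_eq_square algebra_simps)
    hence "t\<^sup>2 mod 4 = (1 + 4 * (s\<^sup>2 + s)) mod 4" by (rule arg_cong)
    also have "\<dots> = 1 mod 4" by (rule mod_mult_self2)
    finally show ?thesis by simp
  qed
  finally have "1 \<in> F" by (simp add: F_def conductors_def D)
  hence "h 1 \<le> sum h F"
    using finite_conductors[OF m(2)] h0 by (intro member_le_sum) (auto simp: F_def)
  hence hs: "(h 1)\<^sup>2 \<le> (sum h F)\<^sup>2" using h0 by (intro power_mono)
  have "divisor_count N \<noteq> 0" using N by (auto simp: divisor_count_def)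
  hence "(1::real) \<le> (real (divisor_count N))\<^sup>2" by simp
  moreover have "(moebius N)\<^sup>2 = 1" using assms(1) by (simp add: moebius_def flip: power_mult)
  hence "(real_of_int (moebius N))\<^sup>2 = 1" by (metis of_int_1 of_int_power)
  ultimately have c: "1 \<le> (real (divisor_count N) * of_int (moebius N))\<^sup>2"
    by (simp add: power_mult_distrib)
  have "(h 1)\<^sup>2 * 1 \<le> (sum h F)\<^sup>2 * (real (divisor_count N) * of_int (moebius N))\<^sup>2"
    using hs c by (intro mult_mono) auto
  also have "\<dots> = (\<Sum>f\<in>F. h f * mu_tilde t f n N)\<^sup>2"
    by (simp add: mu_tilde_irreducible[OF assms(1,2)] sum_distrib_right power_mult_distrib flip: sum_distrib_right)
  finally have "(h 1)\<^sup>2 \<le> (\<Sum>f\<in>F. h f * mu_tilde t f n N)\<^sup>2" by simp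
  moreover have "4 * real m \<le> 16 * real n" using m(1) zero_le_power2[of t] by linarith
  ultimately have "(h 1)\<^sup>2 / (16 * real n) \<le> (\<Sum>f\<in>F. h f * mu_tilde t f n N)\<^sup>2 / (4 * real m)"
    using m(2) by (intro frac_le) auto
  thus ?thesis unfolding cmod_D_coeff_power2[OF m] D by (simp add: h_def F_def)
qed

section \<open>Counting reduced forms on average\<close>

text \<open>With \<open>+ t\<close> the \<open>u\<close> are the negatives of the roots of x^2 - t x
  + n modulo \<open>a\<close>; each residue is represented once in \<open>{1..a}\<close>.\<close>

definition root_pairs :: "nat \<Rightarrow> nat \<Rightarrow> int \<Rightarrow> (nat \<times> nat) set" where
  "root_pairs A n t = {(a, u). a \<in> {1..A} \<and> u \<in> {1..a} \<and> int a dvd (int u)\<^sup>2 + t * int u + int n}"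

lemma finite_root_pairs: "finite (root_pairs A n t)"
  by (rule finite_subset[of _ "{1..A} \<times> {1..A}"]) (auto simp: root_pairs_def)

text \<open>A root \<open>u\<close> of \<open>x\<^sup>2 + t x + n\<close> modulo \<open>a\<close> yields the form with middle coefficient \<open>b \<equiv> t + 2 u\<close>
  modulo \<open>2 a\<close>.\<close>

lemma card_root_pairs_le_class_number:
  assumes "n > 0" "t\<^sup>2 \<le> int n" "4 * A\<^sup>2 \<le> n"
  shows "real (card (root_pairs A n t)) / 3 \<le> weighted_class_number (t\<^sup>2 - 4 * int n)"
proof -
  \<comment> \<open>The shift by a multiple of \<open>a\<close> that brings the middle coefficient
    into (-a, a].\<close>
  define k where "k a u = (int a - (t + 2 * int u)) div (2 * int a)" for a u :: nat
  define v where "v a u = int u + int a * k a u" for a u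
  define G where "G = (\<lambda>(a, u). (int a, t + 2 * v a u, ((v a u)\<^sup>2 + t * v a u + int n) div int a))"
  have b_eq: "t + 2 * v a u = int a - (int a - (t + 2 * int u)) mod (2 * int a)" for a u
    unfolding v_def k_def using div_mult_mod_eq[of "int a - (t + 2 * int u)" "2 * int a"]
    by (simp add: algebra_simps)
  have inj: "inj_on G (root_pairs A n t)"
  proof (rule inj_onI)
    fix z z' assume z: "z \<in> root_pairs A n t" "z' \<in> root_pairs A n t" "G z = G z'"
    obtain a u a' u' where zz: "z = (a, u)" "z' = (a', u')" by (metis prod.exhaust)
    have a: "a = a'" and vv: "v a u = v a u'" using z(3) by (auto simp: zz G_def)
    have "int u - int u' = int a * (k a u' - k a u)" using vv by (simp add: v_def algebra_simps)
    hence "int a dvd int u - int u'" by simp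
    moreover have "\<bar>int u - int u'\<bar> < int a" using z a by (auto simp: zz root_pairs_def)
    ultimately have "int u - int u' = 0" by (metis abs_dvd_iff dvd_abs_iff zdvd_not_zless abs_ge_zero zero_less_abs_iff)
    thus "z = z'" using a zz by simp
  qed
  have "real (card (G ` root_pairs A n t)) / 3 \<le> weighted_class_number (- (4 * int n - t\<^sup>2))"
  proof (rule card_strictly_reduced_le_weighted_class_number)
    fix a b c assume "(a, b, c) \<in> G ` root_pairs A n t"
    then obtain d u where du: "(d, u) \<in> root_pairs A n t" "(a, b, c) = G (d, u)" by auto
    have d: "1 \<le> d" "d \<le> A" and dvd: "int d dvd (int u)\<^sup>2 + t * int u + int n"
      using du(1) by (auto simp: root_pairs_def)
    define w where "w = v d u"
    have abc: "a = int d" "b = t + 2 * w" "c = (w\<^sup>2 + t * w + int n) div int d"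
      using du(2) by (auto simp: G_def w_def)
    have "[w = int u] (mod int d)" by (simp add: w_def v_def cong_def)
    hence "[w\<^sup>2 + t * w + int n = (int u)\<^sup>2 + t * int u + int n] (mod int d)"
      by (intro cong_add cong_mult cong_pow cong_refl)
    hence "int d dvd w\<^sup>2 + t * w + int n" using dvd by (simp add: cong_dvd_iff)
    hence ac: "a * c = w\<^sup>2 + t * w + int n" by (simp add: abc)
    have disc: "4 * a * c - b\<^sup>2 = 4 * int n - t\<^sup>2"
      using ac by (simp add: abc(2) power2_eq_square algebra_simps)
    have "b = a - (a - (t + 2 * int u)) mod (2 * a)" using b_eq[of d u] by (simp add: abc w_def)
    moreover have "0 < 2 * a" using d(1) abc(1) by simp
    ultimately have b: "- a < b" "b \<le> a"
      using pos_mod_bound[of "2 * a" "a - (t + 2 * int u)"] pos_mod_sign[of "2 * a" "a - (t + 2 * int u)"]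
      by linarith+
    \<comment> \<open>From \<open>4 * a\<^sup>2 \<le> n\<close> and
      \<open>4 * a * c \<ge> 4 * n - t\<^sup>2 \<ge> 3 * n\<close> follows the strict inequality
      \<open>a < c\<close>.\<close>
    have "a\<^sup>2 \<le> (int A)\<^sup>2" using d abc(1) by (intro power_mono) auto
    moreover have "int (4 * A\<^sup>2) \<le> int n" using assms(3) by (simp only: of_nat_le_iff)
    hence "4 * (int A)\<^sup>2 \<le> int n" by simp
    ultimately have "4 * a\<^sup>2 \<le> int n" by linarith
    moreover have "4 * a * c \<ge> 3 * int n"
      using disc assms(2) zero_le_power2[of b] by linarith
    ultimately have "a * a < a * c" using assms(1) by (simp add: power2_eq_square mult.assoc)
    hence "a < c" using d(1) abc(1) by simp
    with b disc show "- a < b \<and> b \<le> a \<and> a < c \<and> 4 * a * c - b\<^sup>2 = 4 * int n - t\<^sup>2" by blast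
  qed
  thus ?thesis by (simp add: card_image[OF inj])
qed

section \<open>Counting pairs over a residue class of traces\<close>

lemma card_residue_class_ge:
  fixes r :: int
  assumes "M > 0"
  shows "X div M \<le> card {t \<in> {1..int X}. [t = r] (mod int M)}"
proof -
  \<comment> \<open>The representative is taken in \<open>{1..M}\<close> because the blocks of
    length \<open>M\<close> start at 1.\<close>
  define r' where "r' = (r - 1) mod int M + 1"
  have r': "1 \<le> r'" "r' \<le> int M" using assms by (auto simp: r'_def add1_zle_eq)
  have r'_cong: "[r' = r] (mod int M)"
  proof -
    have "[(r - 1) mod int M + 1 = (r - 1) + 1] (mod int M)"
      by (intro cong_add cong_refl) (simp add: cong_def)
    thus ?thesis by (simp add: r'_def)
  qed
  let ?f = "\<lambda>j::nat. int j * int M + r'"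
  have "?f ` {..<X div M} \<subseteq> {t \<in> {1..int X}. [t = r] (mod int M)}"
  proof (rule image_subsetI)
    fix j assume "j \<in> {..<X div M}"
    hence "Suc j \<le> X div M" by simp
    hence "Suc j * M \<le> X" using assms by (simp add: less_eq_div_iff_mult_less_eq)
    hence "int (Suc j * M) \<le> int X" by (simp only: of_nat_le_iff)
    hence "?f j \<le> int X" using r' by (simp add: algebra_simps)
    moreover have "1 \<le> ?f j" using r' by (simp add: add_increasing)
    moreover have "[?f j = r] (mod int M)"
      using r'_cong by (simp add: cong_def)
    ultimately show "?f j \<in> {t \<in> {1..int X}. [t = r] (mod int M)}" by simp
  qed
  moreover have "inj_on ?f {..<X div M}" using assms by (auto simp: inj_on_def)
  moreover have "finite {t \<in> {1..int X}. [t = r] (mod int M)}"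
    by (rule finite_subset[of _ "{1..int X}"]) auto
  ultimately have "card {..<X div M} \<le> card {t \<in> {1..int X}. [t = r] (mod int M)}"
    by (intro card_inj_on_le)
  thus ?thesis by simp
qed

text \<open>For fixed \<open>a\<close> and \<open>u\<close> coprime to \<open>a\<close>, the divisibility determines \<open>t\<close> modulo \<open>a\<close>.\<close>

lemma sum_card_root_pairs_ge:
  fixes t0 :: int
  assumes "N > 0"
  shows "(\<Sum>a | a \<in> {1..A} \<and> coprime a N. totient a * (X div (a * N))) \<le>
    (\<Sum>t | t \<in> {1..int X} \<and> [t = t0] (mod int N). card (root_pairs A n t))"
proof -
  define T where "T = {t \<in> {1..int X}. [t = t0] (mod int N)}"
  define I where "I = {a \<in> {1..A}. coprime a N}"
  define P where "P = Sigma I totatives"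
  define R where "R = (\<lambda>(a, u) t. int a dvd (int u)\<^sup>2 + t * int u + int n)"
  have fin: "finite T" by (rule finite_subset[of _ "{1..int X}"]) (auto simp: T_def)
  have finI: "finite I" by (simp add: I_def)
  hence finP: "finite P" by (simp add: P_def)
  have ge: "X div (a * N) \<le> card {t \<in> T. R (a, u) t}" if "(a, u) \<in> P" for a u
  proof -
    have a: "a > 0" "coprime a N" and u: "coprime u a" using that
      by (auto simp: P_def I_def in_totatives_iff)
    have "coprime (int u) (int a)" using u by simp
    then obtain i where i: "[int u * i = 1] (mod int a)" using cong_solve_coprime_int by blast
    \<comment> \<open>The solution of u^2 + s u + n = 0 modulo \<open>a\<close>, with
      \<open>i\<close> the inverse of \<open>u\<close>. It is then merged with \<open>t0\<close>
      into one class modulo \<open>a * N\<close>.\<close>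
    define s where "s = - ((int u)\<^sup>2 + int n) * i"
    have "coprime (int a) (int N)" using a by simp
    then obtain r where r: "[r = s] (mod int a)" "[r = t0] (mod int N)"
      using binary_chinese_remainder_int by blast
    have "{t \<in> {1..int X}. [t = r] (mod int (a * N))} \<subseteq> {t \<in> T. R (a, u) t}"
    proof clarify
      fix t assume t: "t \<in> {1..int X}" "[t = r] (mod int (a * N))"
      have "[t = r] (mod int N)" "[t = r] (mod int a)"
        by (rule cong_dvd_modulus[OF t(2)]; simp)+
      hence tN: "[t = t0] (mod int N)" and ta: "[t = s] (mod int a)"
        using r cong_trans by blast+
      have "[(int u)\<^sup>2 + t * int u + int n = (int u)\<^sup>2 + s * int u + int n] (mod int a)"
        using ta by (intro cong_add cong_mult cong_refl)
      also have "(int u)\<^sup>2 + s * int u + int n = ((int u)\<^sup>2 + int n) * (1 - int u * i)"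
        by (simp add: s_def algebra_simps)
      also have "[\<dots> = ((int u)\<^sup>2 + int n) * (1 - 1)] (mod int a)"
        using i by (intro cong_mult cong_diff cong_refl)
      finally have "int a dvd (int u)\<^sup>2 + t * int u + int n" by (simp add: cong_0_iff)
      thus "t \<in> T \<and> R (a, u) t" using t(1) tN by (simp add: T_def R_def)
    qed
    hence "card {t \<in> {1..int X}. [t = r] (mod int (a * N))} \<le> card {t \<in> T. R (a, u) t}"
      using fin by (intro card_mono) auto
    thus ?thesis using card_residue_class_ge[of "a * N" X r] a assms by simp
  qed
  have "(\<Sum>a\<in>I. totient a * (X div (a * N))) = (\<Sum>a\<in>I. \<Sum>u\<in>totatives a. X div (a * N))"
    by (simp add: totient_def)
  also have "\<dots> = (\<Sum>(a, u)\<in>P. X div (a * N))"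
    unfolding P_def using finI by (subst sum.Sigma) auto
  also have "\<dots> \<le> (\<Sum>z\<in>P. card {t \<in> T. R z t})"
    using ge by (intro sum_mono) auto
  also have "\<dots> = (\<Sum>z\<in>P. \<Sum>t\<in>T. if R z t then 1 else 0)"
    using fin by (simp add: sum.If_cases Int_def)
  also have "\<dots> = (\<Sum>t\<in>T. \<Sum>z\<in>P. if R z t then 1 else 0)" by (rule sum.swap)
  also have "\<dots> = (\<Sum>t\<in>T. card {z \<in> P. R z t})"
    using finP by (simp add: sum.If_cases Int_def)
  also have "\<dots> \<le> (\<Sum>t\<in>T. card (root_pairs A n t))"
    by (intro sum_mono card_mono finite_root_pairs)
       (auto simp: P_def I_def R_def root_pairs_def in_totatives_iff)
  finally show ?thesis by (simp add: T_def I_def)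
qed

text \<open>Sum \<open>a = (\<Sum>d | a. totient d)\<close> over the \<open>a \<le> A\<close> coprime to \<open>N\<close>.\<close>

lemma sum_totient_ratio_ge:
  assumes "N > 0" "J \<ge> 2"
  shows "real J / 4 \<le> (\<Sum>a | a \<in> {1..N * J} \<and> coprime a N. real (totient a) / real a)"
proof -
  define A where "A = N * J"
  define I where "I = {a \<in> {1..A}. coprime a N}"
  have fin: "finite I" by (simp add: I_def)
  have A0: "A > 0" using assms by (simp add: A_def)
  \<comment> \<open>The progression 1 modulo \<open>N\<close> is coprime to \<open>N\<close> and
    already has a sum of order \<open>N * J\<^sup>2\<close>.\<close>
  have "(\<lambda>j. 1 + j * N) ` {..<J} \<subseteq> I"
  proof (rule image_subsetI)
    fix j assume "j \<in> {..<J}"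
    hence "Suc j * N \<le> J * N" by (intro mult_le_mono) auto
    hence "1 + j * N \<le> A" using assms by (simp add: A_def mult.commute)
    moreover have "coprime (1 + j * N) N"
      by (metis add.commute coprime_1_left gcd_add_mult coprime_iff_gcd_eq_1 gcd.commute mult.commute)
    ultimately show "1 + j * N \<in> I" by (simp add: I_def)
  qed
  hence "(\<Sum>a\<in>(\<lambda>j. 1 + j * N) ` {..<J}. real a) \<le> (\<Sum>a\<in>I. real a)"
    using fin by (intro sum_mono2) auto
  moreover have "(\<Sum>a\<in>(\<lambda>j. 1 + j * N) ` {..<J}. real a) = (\<Sum>j<J. 1 + real j * real N)"
    using assms by (subst sum.reindex) (auto simp: inj_on_def)
  moreover have "real N * (real J)\<^sup>2 / 4 \<le> (\<Sum>j<J. 1 + real j * real N)"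
  proof -
    have "(\<Sum>j<J. real j) = real J * (real J - 1) / 2"
      by (induction J) (auto simp: field_simps)
    moreover have "(\<Sum>j<J. 1 + real j * real N) = real J + real N * (\<Sum>j<J. real j)"
      by (simp add: sum.distrib sum_distrib_left mult.commute)
    ultimately have "(\<Sum>j<J. 1 + real j * real N) = real J + real N * (real J * (real J - 1) / 2)"
      by simp
    moreover have "real J * (real J / 2) \<le> real J * (real J - 1)" using assms by (intro mult_left_mono) auto
    hence "real N * ((real J)\<^sup>2 / 4) \<le> real N * (real J * (real J - 1) / 2)"
      by (intro mult_left_mono) (auto simp: power2_eq_square)
    ultimately show ?thesis using of_nat_0_le_iff[of J, where ?'a = real] by linarith
  qed
  ultimately have low: "real N * (real J)\<^sup>2 / 4 \<le> (\<Sum>a\<in>I. real a)" by linarith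
  have "(\<Sum>a\<in>I. real a) = (\<Sum>a\<in>I. \<Sum>d\<in>I. if d dvd a then real (totient d) else 0)"
  proof (rule sum.cong[OF refl])
    fix a assume a: "a \<in> I"
    \<comment> \<open>The set \<open>I\<close> is closed under divisors, so both sums may run over
      \<open>I\<close>.\<close>
    have "d \<in> I" if "d dvd a" for d
    proof -
      have "d \<le> a" "d > 0" using that a by (auto simp: I_def dvd_imp_le intro: Nat.gr0I)
      thus ?thesis using a coprime_divisors[OF that dvd_refl, of N] by (auto simp: I_def)
    qed
    hence eq: "{d. d dvd a} = {d \<in> I. d dvd a}" by auto
    have "real a = (\<Sum>d | d dvd a. real (totient d))"
      by (metis totient_divisor_sum of_nat_sum)
    also have "\<dots> = (\<Sum>d\<in>I. if d dvd a then real (totient d) else 0)"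
      unfolding eq using fin by (rule sum.inter_filter)
    finally show "real a = (\<Sum>d\<in>I. if d dvd a then real (totient d) else 0)" .
  qed
  also have "\<dots> = (\<Sum>d\<in>I. \<Sum>a\<in>I. if d dvd a then real (totient d) else 0)" by (rule sum.swap)
  also have "\<dots> \<le> (\<Sum>d\<in>I. real A * (real (totient d) / real d))"
  proof (rule sum_mono)
    fix d assume "d \<in> I"
    hence d: "d > 0" by (simp add: I_def)
    have "{a \<in> I. d dvd a} \<subseteq> (\<lambda>j. d * j) ` {1..A div d}"
    proof clarify
      fix a assume "a \<in> I" "d dvd a"
      then obtain j where j: "a = d * j" by blast
      have "1 \<le> a" "a \<le> A" using \<open>a \<in> I\<close> by (auto simp: I_def)
      hence "j \<in> {1..A div d}" using d by (auto simp: j less_eq_div_iff_mult_less_eq mult.commute Suc_le_eq)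
      thus "a \<in> (\<lambda>j. d * j) ` {1..A div d}" using j by blast
    qed
    hence "card {a \<in> I. d dvd a} \<le> card {1..A div d}" by (intro surj_card_le) auto
    hence "real (card {a \<in> I. d dvd a}) \<le> real (A div d)" by simp
    also have "\<dots> \<le> real A / real d" by (rule of_nat_div_le_of_nat)
    finally have c: "real (card {a \<in> I. d dvd a}) \<le> real A / real d" .
    have "(\<Sum>a\<in>I. if d dvd a then real (totient d) else 0) = real (card {a \<in> I. d dvd a}) * real (totient d)"
      using fin by (simp add: sum.If_cases Int_def)
    also have "\<dots> \<le> real A / real d * real (totient d)" using c by (intro mult_right_mono) auto
    finally show "(\<Sum>a\<in>I. if d dvd a then real (totient d) else 0) \<le> real A * (real (totient d) / real d)"
      by simp
  qed
  also have "\<dots> = real A * (\<Sum>d\<in>I. real (totient d) / real d)" by (simp add: sum_distrib_left)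
  finally have "real A * (real J / 4) \<le> real A * (\<Sum>d\<in>I. real (totient d) / real d)"
    using low by (simp add: A_def power2_eq_square)
  thus ?thesis using A0 by (simp add: I_def A_def)
qed

text \<open>The length \<open>X = 2 * N * A\<close> with \<open>A = N * J\<close> gives every
  progression modulo \<open>a * N\<close>, \<open>a \<le> A\<close>, at least \<open>A / a\<close>
  members. The pairs then number at least \<open>A\<close> times the sum of the totient ratios, that
  is \<open>N * J\<^sup>2 / 4\<close>, and a third of this survives the class weights. The bound on
  \<open>n\<close> ensures \<open>t\<^sup>2 \<le> n\<close> and
  \<open>4 * A\<^sup>2 \<le> n\<close>.\<close>

lemma sum_class_numbers_ge:
  fixes t0 :: int
  assumes "N > 0" "J \<ge> 2" "(2 * N\<^sup>2 * J)\<^sup>2 \<le> n"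
  shows "real N * (real J)\<^sup>2 / 12 \<le>
    (\<Sum>t | t \<in> {1..int (2 * N\<^sup>2 * J)} \<and> [t = t0] (mod int N). weighted_class_number (t\<^sup>2 - 4 * int n))"
proof -
  define A where "A = N * J"
  define X where "X = 2 * N\<^sup>2 * J"
  define I where "I = {a \<in> {1..A}. coprime a N}"
  define T where "T = {t \<in> {1..int X}. [t = t0] (mod int N)}"
  have n0: "n > 0" using assms by (auto intro: Nat.gr0I)
  have "2 * A \<le> X" using assms(1) by (simp add: A_def X_def power2_eq_square)
  hence "(2 * A)\<^sup>2 \<le> X\<^sup>2" by (rule power_mono) simp
  hence A: "4 * A\<^sup>2 \<le> n" using assms(3) by (simp add: X_def power_mult_distrib)
  have tn: "t\<^sup>2 \<le> int n" if "t \<in> T" for t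
  proof -
    have "t\<^sup>2 \<le> (int X)\<^sup>2" using that by (intro power_mono) (auto simp: T_def)
    also have "\<dots> = int (X\<^sup>2)" by simp
    also have "\<dots> \<le> int n" using assms(3) by (simp only: of_nat_le_iff X_def)
    finally show ?thesis .
  qed
  have ratio: "real A * (real (totient a) / real a) \<le> real (totient a * (X div (a * N)))" if "a \<in> I" for a
  proof -
    have a: "1 \<le> a" "a \<le> A" using that by (auto simp: I_def)
    have "X = (2 * A) * N" by (simp add: X_def A_def power2_eq_square)
    hence "X div (a * N) = (2 * A) div a" using assms(1) by simp
    \<comment> \<open>Rounding \<open>2 * A / a\<close> down loses less than 1, and
      \<open>1 \<le> A / a\<close>; this is why \<open>X\<close> carries the factor 2.\<close>
    moreover have "real A / real a \<le> real ((2 * A) div a)"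
    proof -
      have "2 * A < a + a * ((2 * A) div a)"
        using dividend_less_times_div[of a "2 * A"] a by simp
      hence "A \<le> a * ((2 * A) div a)" using a(2) by linarith
      hence "real A \<le> real a * real ((2 * A) div a)" by (metis of_nat_le_iff of_nat_mult)
      thus ?thesis using a by (simp add: field_simps)
    qed
    ultimately have "real (totient a) * (real A / real a) \<le> real (totient a) * real (X div (a * N))"
      by (intro mult_left_mono) auto
    thus ?thesis by (simp add: mult.commute)
  qed
  have "real A * (real J / 4) \<le> real A * (\<Sum>a\<in>I. real (totient a) / real a)"
    using sum_totient_ratio_ge[OF assms(1,2)] by (intro mult_left_mono) (simp_all add: I_def A_def)
  also have "\<dots> = (\<Sum>a\<in>I. real A * (real (totient a) / real a))" by (simp add: sum_distrib_left)
  also have "\<dots> \<le> (\<Sum>a\<in>I. real (totient a * (X div (a * N))))" by (intro sum_mono ratio)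
  also have "\<dots> = real (\<Sum>a\<in>I. totient a * (X div (a * N)))" by simp
  also have "\<dots> \<le> real (\<Sum>t\<in>T. card (root_pairs A n t))"
    using sum_card_root_pairs_ge[OF assms(1), where A = A and X = X and n = n and ?t0.0 = t0] by (simp only: of_nat_le_iff I_def T_def)
  also have "\<dots> = 3 * (\<Sum>t\<in>T. real (card (root_pairs A n t)) / 3)"
    by (simp flip: sum_divide_distrib)
  also have "\<dots> \<le> 3 * (\<Sum>t\<in>T. weighted_class_number (t\<^sup>2 - 4 * int n))"
    using card_root_pairs_le_class_number[OF n0 tn A] by (intro mult_left_mono sum_mono) auto
  finally have "real N * (real J)\<^sup>2 / 12 \<le> (\<Sum>t\<in>T. weighted_class_number (t\<^sup>2 - 4 * int n))"
    by (simp add: A_def power2_eq_square)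
  thus ?thesis by (simp add: T_def X_def)
qed

text \<open>Cauchy-Schwarz over the chosen class of traces: with \<open>J\<close> of order sqrt n
  the class numbers add up to order n over at most sqrt n traces, so their squares add up to order
  n^(3/2), and the normalisation removes a factor n.\<close>

lemma sum_D_coeff_ge:
  assumes "squarefree N" "coprime n N" "n \<ge> 16 * N ^ 4"
  shows "1 / (294912 * real N ^ 6) * sqrt (real n) \<le> (\<Sum>t | t\<^sup>2 < 4 * int n. (cmod (D_coeff N t n))\<^sup>2)"
proof -
  have N: "N > 0" using assms(1) by (auto intro: Nat.gr0I)
  have n0: "n > 0" using assms(3) N by (auto intro: Nat.gr0I)
  \<comment> \<open>The largest integer with \<open>X \<le> sqrt n\<close>. The bound
    \<open>n \<ge> 16 * N ^ 4\<close> makes the quotient at least 2, so rounding down loses at most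
    half.\<close>
  define J where "J = nat \<lfloor>sqrt (real n) / (2 * (real N)\<^sup>2)\<rfloor>"
  define X where "X = 2 * N\<^sup>2 * J"
  have "(4 * (real N)\<^sup>2)\<^sup>2 = real (16 * N ^ 4)" by (simp add: power_mult_distrib flip: power_mult)
  also have "\<dots> \<le> real n" using assms(3) by (simp only: of_nat_le_iff)
  finally have "4 * (real N)\<^sup>2 \<le> sqrt (real n)" by (rule real_le_rsqrt)
  hence x2: "2 \<le> sqrt (real n) / (2 * (real N)\<^sup>2)" using N by (simp add: field_simps)
  have floor: "2 \<le> nat \<lfloor>x\<rfloor>" "real (nat \<lfloor>x\<rfloor>) \<le> x" "x / 2 \<le> real (nat \<lfloor>x\<rfloor>)" if "2 \<le> x" for x :: real
    using that by linarith+
  have J2: "J \<ge> 2" and J_le: "real J \<le> sqrt (real n) / (2 * (real N)\<^sup>2)"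
    and "sqrt (real n) / (2 * (real N)\<^sup>2) / 2 \<le> real J"
    unfolding J_def by (intro floor x2)+
  hence J_ge: "sqrt (real n) / (4 * (real N)\<^sup>2) \<le> real J" by simp
  have "real X \<le> sqrt (real n)" using J_le N by (simp add: X_def field_simps)
  hence "(real X)\<^sup>2 \<le> (sqrt (real n))\<^sup>2" by (intro power_mono) auto
  hence "real (X\<^sup>2) \<le> real n" by simp
  hence Xn: "X\<^sup>2 \<le> n" by (simp only: of_nat_le_iff)
  obtain t0 where t0: "\<And>p x. prime p \<Longrightarrow> p dvd N \<Longrightarrow> \<not> int p dvd x\<^sup>2 - t0 * x + int n"
    using exists_irreducible_trace[OF assms(2) N] by blast
  define T where "T = {t \<in> {1..int X}. [t = t0] (mod int N)}"
  define h where "h t = weighted_class_number (t\<^sup>2 - 4 * int n)" for t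
  have Tn: "t\<^sup>2 < 4 * int n" if "t \<in> T" for t
  proof -
    have "t\<^sup>2 \<le> (int X)\<^sup>2" using that by (intro power_mono) (auto simp: T_def)
    also have "\<dots> = int (X\<^sup>2)" by simp
    also have "\<dots> \<le> int n" using Xn by (simp only: of_nat_le_iff)
    finally show ?thesis using n0 by linarith
  qed
  have low: "(h t)\<^sup>2 / (16 * real n) \<le> (cmod (D_coeff N t n))\<^sup>2" if t: "t \<in> T" for t
    unfolding h_def
  proof (rule class_number_le_cmod_D_coeff[OF assms(1) _ Tn[OF t]])
    fix p x assume p: "prime p" "p dvd N"
    have "[t = t0] (mod int p)"
      using t p(2) by (auto simp: T_def intro: cong_dvd_modulus[of t t0 "int N"])
    hence "[x\<^sup>2 - t * x + int n = x\<^sup>2 - t0 * x + int n] (mod int p)"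
      by (intro cong_add cong_diff cong_mult cong_refl)
    thus "\<not> int p dvd x\<^sup>2 - t * x + int n" using t0[OF p, of x] by (simp add: cong_dvd_iff)
  qed
  have sumh: "real N * (real J)\<^sup>2 / 12 \<le> (\<Sum>t\<in>T. h t)"
    unfolding T_def h_def X_def using sum_class_numbers_ge[OF N J2, of n t0] Xn by (simp add: X_def)
  have "card T \<le> card {1..int X}" by (intro card_mono) (auto simp: T_def)
  hence cT: "real (card T) \<le> real X" by simp
  have "(real N * (real J)\<^sup>2 / 12)\<^sup>2 \<le> (\<Sum>t\<in>T. h t)\<^sup>2" using sumh by (intro power_mono) auto
  also have "\<dots> \<le> (\<Sum>t\<in>T. (h t)\<^sup>2) * real (card T)" by (rule sum_squared_le_sum_of_squares)
  also have "\<dots> \<le> (\<Sum>t\<in>T. (h t)\<^sup>2) * real X" using cT by (intro mult_left_mono sum_nonneg) auto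
  finally have "(real N * (real J)\<^sup>2 / 12)\<^sup>2 \<le> (\<Sum>t\<in>T. (h t)\<^sup>2) * (2 * (real N)\<^sup>2 * real J)"
    by (simp add: X_def)
  \<comment> \<open>Both sides now show the factor \<open>X\<close>, since \<open>(N * J\<^sup>2 /
    12)\<^sup>2 = (J ^ 3 / 288) * (2 * N\<^sup>2 * J)\<close>.\<close>
  hence "(real J ^ 3 / 288) * (2 * (real N)\<^sup>2 * real J) \<le> (\<Sum>t\<in>T. (h t)\<^sup>2) * (2 * (real N)\<^sup>2 * real J)"
    by (simp add: power2_eq_square power3_eq_cube mult_ac)
  hence sq: "real J ^ 3 / 288 \<le> (\<Sum>t\<in>T. (h t)\<^sup>2)"
    using N J2 by (subst (asm) mult_le_cancel_right_pos) auto
  have "(sqrt (real n) / (4 * (real N)\<^sup>2)) ^ 3 \<le> real J ^ 3" using J_ge by (intro power_mono) auto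
  moreover have "(sqrt (real n) / (4 * (real N)\<^sup>2)) ^ 3 = real n * sqrt (real n) / (64 * real N ^ 6)"
    by (simp add: power_divide power_mult_distrib power3_eq_cube flip: power_mult)
  ultimately have "real n * sqrt (real n) / (64 * real N ^ 6) / 288 \<le> real J ^ 3 / 288"
    by (intro divide_right_mono) simp_all
  also note sq
  finally have "real n * sqrt (real n) / (64 * real N ^ 6) / 288 \<le> (\<Sum>t\<in>T. (h t)\<^sup>2)" .
  hence "real n * sqrt (real n) / (64 * real N ^ 6) / 288 / (16 * real n) \<le> (\<Sum>t\<in>T. (h t)\<^sup>2) / (16 * real n)"
    by (intro divide_right_mono) auto
  \<comment> \<open>The constant is 64 * 288 * 16.\<close>
  hence "1 / (294912 * real N ^ 6) * sqrt (real n) \<le> (\<Sum>t\<in>T. (h t)\<^sup>2) / (16 * real n)"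
    using n0 by (simp add: field_simps)
  also have "\<dots> = (\<Sum>t\<in>T. (h t)\<^sup>2 / (16 * real n))" by (simp add: sum_divide_distrib)
  also have "\<dots> \<le> (\<Sum>t\<in>T. (cmod (D_coeff N t n))\<^sup>2)" by (intro sum_mono low)
  also have "\<dots> \<le> (\<Sum>t | t\<^sup>2 < 4 * int n. (cmod (D_coeff N t n))\<^sup>2)"
    using Tn by (intro sum_mono2 finite_traces) auto
  finally show ?thesis .
qed

theorem theorem4p7:
  fixes N :: nat
  assumes "squarefree N"
  shows "(\<exists>c::real. c > 0 \<and> (\<exists>n0::nat. \<forall>n::nat. n \<ge> n0 \<longrightarrow> odd n \<longrightarrow> coprime n N \<longrightarrow>
            c * sqrt (real n) \<le> (\<Sum>t | t\<^sup>2 < 4 * int n. (cmod (D_coeff N t n))\<^sup>2))) \<and>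
         (\<exists>C::real. C > 0 \<and> (\<forall>n::nat. n > 1 \<longrightarrow> odd n \<longrightarrow> coprime n N \<longrightarrow>
            (\<Sum>t | t\<^sup>2 < 4 * int n. (cmod (D_coeff N t n))\<^sup>2)
              \<le> C * (sqrt (real n) * (ln (real n))\<^sup>2 * (ln (ln (real n))) ^ 4)))"
proof -
  have N: "N > 0" using assms by (auto intro: Nat.gr0I)
  hence c: "1 / (294912 * real N ^ 6) > 0" by simp
  obtain C where C: "C > 0"
    "\<And>n. n \<ge> 3 \<Longrightarrow> (\<Sum>t | t\<^sup>2 < 4 * int n. (cmod (D_coeff N t n))\<^sup>2)
       \<le> C * (sqrt (real n) * (ln (real n))\<^sup>2 * (ln (ln (real n))) ^ 4)"
    using sum_D_coeff_le[OF N] by blast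
  \<comment> \<open>The upper bound is available from 3 on, where \<open>ln (ln n)\<close> stays
    away from 0.\<close>
  have three: "n \<ge> 3" if "n > 1" "odd n" for n :: nat
  proof -
    have "n \<noteq> 2" using that by auto
    thus ?thesis using that by linarith
  qed
  \<comment> \<open>The threshold for the lower bound is \<open>16 * N ^ 4\<close>.\<close>
  show ?thesis using sum_D_coeff_ge[OF assms] c C three by blast
qed

end
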